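(* Let $k$ be a field of characteristic zero, $m\in\{1,\dots,n\}$, $f_1,\dots,f_m\in k[x_1,\dots,x_n]$ arbitrary, and $g\in k[x_1,\dots,x_n]$ irreducible. The following are equivalent: (i) $g\mid\mathrm{dgcd}(f_1,\dots,f_m)$; (ii) $g^2\mid w(f_1,\dots,f_m)$ for some irreducible polynomial $w\in k[x_1,\dots,x_m]$; (iii) $g^2\mid w(f_1,\dots,f_m)$ for some square-free polynomial $w\in k[x_1,\dots,x_m]$.
   Context: For $f_1,\dots,f_m\in k[x_1,\dots,x_n]$ ($m\le n$), $\mathrm{dgcd}(f_1,\dots,f_m)=\gcd\big(\det(\partial f_a/\partial x_{i_b})_{a,b=1}^m : 1\le i_1<\dots<i_m\le n\big)$, defined up to a nonzero constant factor, and equal to $0$ if all these Jacobian determinants vanish. An element $a$ of a commutative ring $R$ is square-free if it cannot be written as $a=b^2c$ with $b,c\in R$ and $b$ not a unit of $R$. *)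

theory Defs
  imports "HOL-Library.Poly_Mapping" "HOL-Computational_Algebra.Computational_Algebra"
    "HOL-Combinatorics.Permutations"
begin

text \<open>Multivariate polynomials over a coefficient ring 'a in the variables x_0, x_1, x_2, ...
  (indexed by nat): a polynomial is a finitely supported map from monomials (exponent vectors,
  finitely supported maps nat to nat) to coefficients. The ring structure (including
  multiplication) is the one provided by HOL-Library.Poly_Mapping.\<close>

type_synonym 'a mpoly = "(nat \<Rightarrow>\<^sub>0 nat) \<Rightarrow>\<^sub>0 'a"

definition mvars :: "'a::zero mpoly \<Rightarrow> nat set" where
  "mvars p = \<Union> (Poly_Mapping.keys ` Poly_Mapping.keys p)"

text \<open>k[x_1,...,x_n] is rendered as the polynomials in the variables x_0, ..., x_(n-1).\<close>
definition in_vars :: "nat \<Rightarrow> 'a::zero mpoly \<Rightarrow> bool" where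
  "in_vars n p \<longleftrightarrow> mvars p \<subseteq> {..<n}"

definition pdiff :: "nat \<Rightarrow> 'a::comm_semiring_1 mpoly \<Rightarrow> 'a mpoly" where
  "pdiff i p = (\<Sum>t\<in>Poly_Mapping.keys p. Poly_Mapping.single (t - Poly_Mapping.single i 1)
                              (of_nat (Poly_Mapping.lookup t i) * Poly_Mapping.lookup p t))"

definition subst :: "(nat \<Rightarrow> 'a::comm_semiring_1 mpoly) \<Rightarrow> 'a mpoly \<Rightarrow> 'a mpoly" where
  "subst F w = (\<Sum>t\<in>Poly_Mapping.keys w. Poly_Mapping.single 0 (Poly_Mapping.lookup w t) *
                              (\<Prod>i\<in>Poly_Mapping.keys t. F i ^ Poly_Mapping.lookup t i))"

definition detm :: "nat \<Rightarrow> (nat \<Rightarrow> nat \<Rightarrow> 'a::comm_ring_1) \<Rightarrow> 'a" where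
  "detm m A = (\<Sum>p | p permutes {..<m}. of_int (sign p) * (\<Prod>a<m. A a (p a)))"

definition jac_minors :: "nat \<Rightarrow> nat \<Rightarrow> (nat \<Rightarrow> 'a::comm_ring_1 mpoly) \<Rightarrow> 'a mpoly set" where
  "jac_minors n m f = {detm m (\<lambda>a b. pdiff (idx b) (f a)) | idx.
       strict_mono_on {..<m} idx \<and> (\<forall>b<m. idx b < n)}"

definition is_gcd_of :: "'a::comm_semiring_1 set \<Rightarrow> 'a \<Rightarrow> bool" where
  "is_gcd_of A d \<longleftrightarrow> (\<forall>a\<in>A. d dvd a) \<and> (\<forall>e. (\<forall>a\<in>A. e dvd a) \<longrightarrow> e dvd d)"

text \<open>dgcd(f_1,...,f_m): a gcd of all Jacobian m-minors (chosen up to a unit; it is 0 iff all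
  minors vanish).\<close>
definition dgcd :: "nat \<Rightarrow> nat \<Rightarrow> (nat \<Rightarrow> 'a::comm_ring_1 mpoly) \<Rightarrow> 'a mpoly" where
  "dgcd n m f = (SOME d. is_gcd_of (jac_minors n m f) d)"

end

(* Write P for the prime ideal of those p in k[y] with g | p(f). Differentiating p(f) = g q gives
   (grad p)(f) J = q grad g modulo g, where J is the Jacobian matrix.

   If some m-minor is not divisible by g, the rows of J are independent modulo g, so all these gradients
   are parallel modulo g, and they vanish modulo g when g^2 | p(f). A square-free w with g^2 | w(f)
   therefore has all its partial derivatives in P. Take h of minimal degree in P, with d_i h not in P.
   Eliminating y_i from w and d_i w, which have no common factor involving y_i, leaves a nonzero
   element of P free of y_i; one of minimal degree has a gradient not parallel to that of h,
   a contradiction.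

   If g divides all m-minors, take u nonzero modulo g with u J = 0 modulo g. As derivations extend from
   the subring generated by the residues of f to k[x]/(g), u annihilates every vector v that is
   orthogonal to the gradients of P. Hence P is nonzero, and if P = (h), then u is parallel to (grad h)(f),
   which forces g^2 | h(f). If P is not principal, it contains irreducible h involving y_i and r free of
   y_i, and a suitable Eisenstein polynomial r^2 A + B^2 h^2 is irreducible. *)

theory Submission
  imports "Jordan_Normal_Form.Determinant" Defs
begin

subsection \<open>Evaluation and partial derivatives of multivariate polynomials\<close>

text \<open>The ring generated by the residues of the f_a is the image of k[y], so prescribing
  values v_a = D(f_a) in k[x]/(g) defines a derivation D exactly when v is orthogonal modulo g to
  the gradients of P. Once D is extended, up to a factor, to all coordinates, D(f_a) = sum_j (d_j
  f_a) D(x_j), and u J = 0 gives u . v = 0. If P = (h), every v orthogonal to the single vector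
  (grad h)(f) qualifies; this is what makes u parallel to it. Then (grad h)(f) J vanishes modulo g,
  and with h(f) = g q this says that g divides q d_l g for every l; in characteristic zero some d_l
  g is not divisible by g, so g | q. In the non-principal case g divides both r(f) and h(f), so
  every element of the ideal (r^2, h^2) yields a multiple of g^2 on substitution. Only
  irreducibility has to be arranged, and that is the freedom in A and B. Fractions are avoided:
  division is pseudo-division, and statements over the fraction field of k[x]/(g) carry a multiplier
  not divisible by g.\<close>

abbreviation pC :: "'a::zero \<Rightarrow> 'a mpoly" where
  "pC \<equiv> Poly_Mapping.single 0"

definition pX :: "nat \<Rightarrow> 'a::zero_neq_one mpoly" where
  "pX i = Poly_Mapping.single (Poly_Mapping.single i 1) 1"

definition mono_eval :: "(nat \<Rightarrow> 'b::comm_semiring_1) \<Rightarrow> (nat \<Rightarrow>\<^sub>0 nat) \<Rightarrow> 'b" where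
  "mono_eval F t = (\<Prod>i\<in>Poly_Mapping.keys t. F i ^ Poly_Mapping.lookup t i)"

lemma mono_eval_superset:
  assumes "finite S" "Poly_Mapping.keys t \<subseteq> S"
  shows "mono_eval F t = (\<Prod>i\<in>S. F i ^ Poly_Mapping.lookup t i)"
  unfolding mono_eval_def using assms
  by (intro prod.mono_neutral_left) (auto simp: in_keys_iff)

lemma mono_eval_add: "mono_eval F (s + t) = mono_eval F s * mono_eval F t"
proof -
  let ?S = "Poly_Mapping.keys s \<union> Poly_Mapping.keys t"
  have "mono_eval F u = (\<Prod>i\<in>?S. F i ^ Poly_Mapping.lookup u i)" if "u \<in> {s, t, s + t}" for u
    using that keys_add[of s t] by (intro mono_eval_superset) auto
  then show ?thesis by (simp add: lookup_add power_add prod.distrib)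
qed

lemma mono_eval_0 [simp]: "mono_eval F 0 = 1"
  by (simp add: mono_eval_def)

lemma mono_eval_single [simp]: "mono_eval F (Poly_Mapping.single i k) = F i ^ k"
  by (simp add: mono_eval_def)

lemma poly_mapping_sum_singles:
  "(\<Sum>t\<in>Poly_Mapping.keys p. Poly_Mapping.single t (Poly_Mapping.lookup p t)) = p"
  by (rule poly_mapping_eqI)
     (auto simp: lookup_sum lookup_single when_def in_keys_iff
           intro!: trans[OF sum.delta])

lemma mono_eval_pX: "mono_eval (pX :: nat \<Rightarrow> 'a::comm_semiring_1 mpoly) t = Poly_Mapping.single t 1"
proof -
  have pw: "(pX i :: 'a mpoly) ^ k = Poly_Mapping.single (Poly_Mapping.single i k) 1" for i k
    by (induction k) (auto simp: pX_def mult_single single_add[symmetric])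
  have "(\<Prod>i\<in>S. Poly_Mapping.single (Poly_Mapping.single i (Poly_Mapping.lookup t i)) (1::'a))
        = Poly_Mapping.single (\<Sum>i\<in>S. Poly_Mapping.single i (Poly_Mapping.lookup t i)) 1"
    if "finite S" for S
    using that by (induction S) (auto simp: mult_single)
  then show ?thesis
    by (simp add: mono_eval_def pw poly_mapping_sum_singles)
qed

lemma single_conv_mono_eval:
  "Poly_Mapping.single t (c :: 'a::comm_semiring_1) = pC c * mono_eval pX t"
  by (simp add: mono_eval_pX mult_single)

lemma mvars_pC [simp]: "mvars (pC c) = {}"
  by (simp add: mvars_def)

lemma mvars_0 [simp]: "mvars 0 = {}"
  by (simp add: mvars_def)

lemma mvars_1 [simp]: "mvars (1 :: 'a::comm_semiring_1 mpoly) = {}"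
  using mvars_pC[of "1::'a"] by simp

lemma mvars_pX [simp]: "mvars (pX i :: 'a::comm_semiring_1 mpoly) = {i}"
  by (simp add: mvars_def pX_def)

lemma mvars_add: "mvars (p + q) \<subseteq> mvars p \<union> mvars q"
  using keys_add[of p q] unfolding mvars_def by blast

lemma mvars_mult: "mvars (p * q) \<subseteq> mvars p \<union> mvars (q :: 'a::comm_semiring_1 mpoly)"
proof
  fix i assume "i \<in> mvars (p * q)"
  then obtain u where u: "u \<in> Poly_Mapping.keys (p * q)" "i \<in> Poly_Mapping.keys u"
    unfolding mvars_def by blast
  then obtain s t where "u = s + t" "s \<in> Poly_Mapping.keys p" "t \<in> Poly_Mapping.keys q"
    using keys_mult[of p q] by blast
  with u keys_add[of s t] show "i \<in> mvars p \<union> mvars q"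
    unfolding mvars_def by blast
qed

lemma mvars_addI: "mvars p \<subseteq> V \<Longrightarrow> mvars q \<subseteq> V \<Longrightarrow> mvars (p + q) \<subseteq> V"
  using mvars_add[of p q] by blast

lemma mvars_multI:
  "mvars p \<subseteq> V \<Longrightarrow> mvars q \<subseteq> V \<Longrightarrow> mvars (p * q :: 'a::comm_semiring_1 mpoly) \<subseteq> V"
  using mvars_mult[of p q] by blast

lemma mvars_uminus [simp]: "mvars (- p :: 'a::comm_ring_1 mpoly) = mvars p"
  by (simp add: mvars_def in_keys_iff set_eq_iff)

lemma mvars_diffI:
  "mvars p \<subseteq> V \<Longrightarrow> mvars q \<subseteq> V \<Longrightarrow> mvars (p - q :: 'a::comm_ring_1 mpoly) \<subseteq> V"
  using mvars_addI[of p V "- q"] by simp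

lemma mvars_powerI:
  "mvars p \<subseteq> V \<Longrightarrow> mvars (p ^ k :: 'a::comm_semiring_1 mpoly) \<subseteq> V"
  by (induction k) (simp_all add: mvars_multI)

lemma mvars_sumI:
  "(\<And>x. x \<in> S \<Longrightarrow> mvars (p x) \<subseteq> V) \<Longrightarrow> mvars (\<Sum>x\<in>S. p x) \<subseteq> V"
  by (induction S rule: infinite_finite_induct) (simp_all add: mvars_addI)

lemma finite_mvars [simp]: "finite (mvars p)"
  by (simp add: mvars_def)

lemma mvars_empty_iff: "mvars p = {} \<longleftrightarrow> (\<exists>c. p = pC c)"
proof
  assume "mvars p = {}"
  then have "\<forall>t\<in>Poly_Mapping.keys p. t = 0" unfolding mvars_def by auto
  then have "p = pC (Poly_Mapping.lookup p 0)"
    by (intro poly_mapping_eqI) (auto simp: lookup_single when_def in_keys_iff)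
  then show "\<exists>c. p = pC c" by blast
qed auto

text \<open>Reduces an identity between ring homomorphisms or derivations to constants and
  variables. The bound \<open>V\<close> is carried along so that hypotheses about the variables of
  \<open>p\<close> are available in the \<open>var\<close> case.\<close>

lemma mpoly_induct [consumes 1, case_names const var add mult]:
  fixes p :: "'a::comm_semiring_1 mpoly"
  assumes "mvars p \<subseteq> V"
    and const: "\<And>c. P (pC c)"
    and var: "\<And>i. i \<in> V \<Longrightarrow> P (pX i)"
    and add: "\<And>p q. mvars p \<subseteq> V \<Longrightarrow> mvars q \<subseteq> V \<Longrightarrow> P p \<Longrightarrow> P q \<Longrightarrow> P (p + q)"
    and mult: "\<And>p q. mvars p \<subseteq> V \<Longrightarrow> mvars q \<subseteq> V \<Longrightarrow> P p \<Longrightarrow> P q \<Longrightarrow> P (p * q)"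
  shows "P p"
proof -
  define Q where "Q q \<longleftrightarrow> mvars q \<subseteq> V \<and> P q" for q
  have QC: "Q (pC c)" for c by (simp add: Q_def const)
  have Q1: "Q 1" using QC[of 1] by simp
  have QX: "Q (pX i)" if "i \<in> V" for i using that var by (simp add: Q_def)
  have Qadd: "Q (a + b)" if "Q a" "Q b" for a b
    using that add mvars_addI unfolding Q_def by blast
  have Qmult: "Q (a * b)" if "Q a" "Q b" for a b
    using that mult mvars_multI unfolding Q_def by blast
  have Qpow: "Q (a ^ k)" if "Q a" for a k
    by (induction k) (simp_all add: Q1 Qmult that)
  have Qsum: "Q (\<Sum>x\<in>S. a x)" if "\<And>x. x \<in> S \<Longrightarrow> Q (a x)" for S :: "(nat \<Rightarrow>\<^sub>0 nat) set" and a
    using that by (induction S rule: infinite_finite_induct) (use QC[of 0] in \<open>simp_all add: Qadd\<close>)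
  have Qprod: "Q (\<Prod>x\<in>S. a x)" if "\<And>x. x \<in> S \<Longrightarrow> Q (a x)" for S :: "nat set" and a
    using that by (induction S rule: infinite_finite_induct) (simp_all add: Q1 Qmult)
  have "Q (Poly_Mapping.single t (Poly_Mapping.lookup p t))" if "t \<in> Poly_Mapping.keys p" for t
  proof -
    have "Q (\<Prod>i\<in>Poly_Mapping.keys t. pX i ^ Poly_Mapping.lookup t i)"
    proof (rule Qprod)
      fix i assume "i \<in> Poly_Mapping.keys t"
      then have "i \<in> V" using that assms(1) by (auto simp: mvars_def)
      then show "Q (pX i ^ Poly_Mapping.lookup t i)" by (intro Qpow QX)
    qed
    then have "Q (pC (Poly_Mapping.lookup p t) * mono_eval pX t)"
      unfolding mono_eval_def by (intro Qmult QC)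
    then show ?thesis by (simp only: single_conv_mono_eval[symmetric])
  qed
  then have "Q (\<Sum>t\<in>Poly_Mapping.keys p. Poly_Mapping.single t (Poly_Mapping.lookup p t))"
    by (rule Qsum)
  then show ?thesis by (simp add: poly_mapping_sum_singles Q_def)
qed

text \<open>The coefficient map \<open>h\<close> is kept general so that one proof of additivity and
  multiplicativity serves both \<open>subst\<close> and \<open>upoly\<close>.\<close>

definition meval :: "('a::zero \<Rightarrow> 'b::comm_semiring_1) \<Rightarrow> (nat \<Rightarrow> 'b) \<Rightarrow> 'a mpoly \<Rightarrow> 'b" where
  "meval h F p = (\<Sum>t\<in>Poly_Mapping.keys p. h (Poly_Mapping.lookup p t) * mono_eval F t)"

locale coeff_hom =
  fixes h :: "'a::comm_semiring_1 \<Rightarrow> 'b::comm_semiring_1"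
  assumes h0: "h 0 = 0" and h1: "h 1 = 1"
    and hadd: "h (a + b) = h a + h b" and hmult: "h (a * b) = h a * h b"
begin

lemma meval_superset:
  assumes "finite S" "Poly_Mapping.keys p \<subseteq> S"
  shows "meval h F p = (\<Sum>t\<in>S. h (Poly_Mapping.lookup p t) * mono_eval F t)"
  unfolding meval_def using assms
  by (intro sum.mono_neutral_left) (auto simp: in_keys_iff h0)

lemma meval_add: "meval h F (p + q) = meval h F p + meval h F q"
proof -
  let ?S = "Poly_Mapping.keys p \<union> Poly_Mapping.keys q"
  have "meval h F u = (\<Sum>t\<in>?S. h (Poly_Mapping.lookup u t) * mono_eval F t)" if "u \<in> {p, q, p + q}" for u
    using that keys_add[of p q] by (intro meval_superset) auto
  then show ?thesis by (simp add: lookup_add hadd algebra_simps sum.distrib)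
qed

lemma meval_0 [simp]: "meval h F 0 = 0"
  by (simp add: meval_def)

lemma meval_sum: "meval h F (\<Sum>x\<in>S. a x) = (\<Sum>x\<in>S. meval h F (a x))"
  by (induction S rule: infinite_finite_induct) (auto simp: meval_add)

lemma meval_single: "meval h F (Poly_Mapping.single t c) = h c * mono_eval F t"
  using meval_superset[of "{t}" "Poly_Mapping.single t c" F] by simp

lemma meval_mult: "meval h F (p * q) = meval h F p * meval h F q"
proof -
  have "p * q = (\<Sum>s\<in>Poly_Mapping.keys p. \<Sum>t\<in>Poly_Mapping.keys q.
      Poly_Mapping.single (s + t) (Poly_Mapping.lookup p s * Poly_Mapping.lookup q t))"
    by (subst (1) poly_mapping_sum_singles[of p, symmetric],
        subst (1) poly_mapping_sum_singles[of q, symmetric])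
       (simp add: sum_product mult_single)
  then have "meval h F (p * q) = (\<Sum>s\<in>Poly_Mapping.keys p. \<Sum>t\<in>Poly_Mapping.keys q.
      (h (Poly_Mapping.lookup p s) * mono_eval F s) * (h (Poly_Mapping.lookup q t) * mono_eval F t))"
    by (simp add: meval_sum meval_single hmult mono_eval_add mult_ac)
  then show ?thesis by (simp add: meval_def sum_product)
qed

lemma meval_pC [simp]: "meval h F (pC c) = h c"
  by (simp add: meval_single)

lemma meval_1 [simp]: "meval h F 1 = 1"
  using meval_pC[of F 1] by (simp add: h1)

lemma meval_pX [simp]: "meval h F (pX i) = F i"
  by (simp add: pX_def meval_single h1)

lemma meval_power: "meval h F (p ^ k) = meval h F p ^ k"
  by (induction k) (auto simp: meval_mult)

end

lemma subst_meval: "subst F = meval pC F"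
  by (intro ext) (simp add: subst_def meval_def mono_eval_def)

interpretation subst_hom: coeff_hom "pC :: 'a::comm_ring_1 \<Rightarrow> 'a mpoly"
  by standard (auto simp: single_add mult_single)

lemma subst_0 [simp]: "subst F (0 :: 'a::comm_ring_1 mpoly) = 0"
  and subst_1 [simp]: "subst F (1 :: 'a::comm_ring_1 mpoly) = 1"
  and subst_pC [simp]: "subst F (pC (c::'a)) = pC c"
  and subst_pX [simp]: "subst F (pX i :: 'a::comm_ring_1 mpoly) = F i"
  and subst_add: "subst F (p + q) = subst F p + subst F q"
  and subst_mult: "subst F (p * q) = subst F p * subst F q"
  and subst_power: "subst F (p ^ k) = subst F p ^ k"
  by (simp_all add: subst_meval subst_hom.meval_add subst_hom.meval_mult subst_hom.meval_power)

lemma subst_uminus: "subst F (- p :: 'a::comm_ring_1 mpoly) = - subst F p"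
  using subst_add[of F p "- p"] by (simp add: eq_neg_iff_add_eq_0 add.commute)

lemma subst_diff: "subst F (p - q :: 'a::comm_ring_1 mpoly) = subst F p - subst F q"
  using subst_add[of F p "- q"] by (simp add: subst_uminus)

lemma subst_dvd_1:
  fixes c :: "'a::comm_ring_1 mpoly"
  assumes "c dvd 1"
  shows "subst F c dvd 1"
proof -
  obtain d where "1 = c * d" using assms by blast
  then have "1 = subst F c * subst F d" by (metis subst_1 subst_mult)
  then show ?thesis by (rule dvdI)
qed

lemma subst_subst_pX:
  fixes p :: "'a::comm_ring_1 mpoly"
  assumes "\<And>i. i \<in> mvars p \<Longrightarrow> subst F (G i) = pX i"
  shows "subst F (subst G p) = p"
  by (rule mpoly_induct[of p "mvars p"]) (use assms in \<open>auto simp: subst_add subst_mult\<close>)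

lemma subst_cong:
  fixes p :: "'a::comm_ring_1 mpoly"
  assumes "\<And>i. i \<in> mvars p \<Longrightarrow> F i = G i"
  shows "subst F p = subst G p"
  by (rule mpoly_induct[of p "mvars p"]) (use assms in \<open>auto simp: subst_add subst_mult\<close>)

lemma mvars_substI:
  fixes p :: "'a::comm_ring_1 mpoly"
  assumes "\<And>i. i \<in> mvars p \<Longrightarrow> mvars (G i) \<subseteq> V"
  shows "mvars (subst G p) \<subseteq> V"
proof (rule mpoly_induct[of p "mvars p"])
qed (use assms in \<open>simp_all add: subst_add subst_mult mvars_addI mvars_multI\<close>)

section \<open>Formal partial derivatives, product rule and chain rule\<close>

lemma pdiff_superset:
  assumes "finite S" "Poly_Mapping.keys p \<subseteq> S"
  shows "pdiff i p = (\<Sum>t\<in>S. Poly_Mapping.single (t - Poly_Mapping.single i 1)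
           (of_nat (Poly_Mapping.lookup t i) * Poly_Mapping.lookup p t))"
  unfolding pdiff_def using assms
  by (intro sum.mono_neutral_left) (auto simp: in_keys_iff)

lemma pdiff_add: "pdiff i (p + q) = pdiff i p + pdiff i q"
proof -
  let ?S = "Poly_Mapping.keys p \<union> Poly_Mapping.keys q"
  have "pdiff i u = (\<Sum>t\<in>?S. Poly_Mapping.single (t - Poly_Mapping.single i 1)
           (of_nat (Poly_Mapping.lookup t i) * Poly_Mapping.lookup u t))" if "u \<in> {p, q, p + q}" for u
    using that keys_add[of p q] by (intro pdiff_superset) auto
  then show ?thesis by (simp add: lookup_add single_add algebra_simps sum.distrib)
qed

lemma pdiff_0 [simp]: "pdiff i 0 = 0"
  by (simp add: pdiff_def)

lemma pdiff_sum: "pdiff i (\<Sum>x\<in>S. a x) = (\<Sum>x\<in>S. pdiff i (a x))"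
  by (induction S rule: infinite_finite_induct) (auto simp: pdiff_add)

lemma pdiff_single: "pdiff i (Poly_Mapping.single t c) =
    Poly_Mapping.single (t - Poly_Mapping.single i 1) (of_nat (Poly_Mapping.lookup t i) * c)"
  using pdiff_superset[of "{t}" "Poly_Mapping.single t c" i] by simp

lemma pdiff_pC [simp]: "pdiff i (pC c) = 0"
  by (simp add: pdiff_single)

lemma pdiff_1 [simp]: "pdiff i (1 :: 'a::comm_semiring_1 mpoly) = 0"
  using pdiff_pC[of i "1::'a"] by simp

lemma pdiff_pX: "pdiff i (pX j) = (if i = j then 1 else 0)"
  by (auto simp: pX_def pdiff_single lookup_single when_def)

lemma pdiff_mult_single:
  fixes a b :: "'a::comm_semiring_1"
  shows "pdiff i (Poly_Mapping.single s a * Poly_Mapping.single t b) =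
     Poly_Mapping.single s a * pdiff i (Poly_Mapping.single t b)
     + Poly_Mapping.single t b * pdiff i (Poly_Mapping.single s a)"
proof -
  let ?e = "Poly_Mapping.single i (1::nat)"
  \<comment> \<open>Exponents are subtracted with truncation, so this identity needs x_i to occur in
    \<open>t\<close>; where it does not, the coefficient \<open>of_nat 0\<close> kills the
    term.\<close>
  have eq: "s + (t - ?e) = s + t - ?e" if "Poly_Mapping.lookup t i \<noteq> 0" for s t
    by (rule poly_mapping_eqI)
       (use that in \<open>auto simp: lookup_add lookup_minus lookup_single when_def\<close>)
  have 1: "Poly_Mapping.single s a * pdiff i (Poly_Mapping.single t b)
      = Poly_Mapping.single (s + t - ?e) (of_nat (Poly_Mapping.lookup t i) * (a * b))" for s t a b
    using eq[of t s] by (cases "Poly_Mapping.lookup t i = 0") (simp_all add: pdiff_single mult_single mult_ac)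
  show ?thesis
    unfolding 1 unfolding mult_single pdiff_single
    by (simp add: add.commute lookup_add single_add[symmetric] algebra_simps)
qed

lemma pdiff_mult: "pdiff i (p * q) = p * pdiff i q + q * pdiff i p"
proof -
  let ?s = "\<lambda>p t. Poly_Mapping.single t (Poly_Mapping.lookup p t)"
  have e: "p * q = (\<Sum>s\<in>Poly_Mapping.keys p. \<Sum>t\<in>Poly_Mapping.keys q. ?s p s * ?s q t)"
    by (simp only: sum_product[symmetric] poly_mapping_sum_singles)
  have "pdiff i (p * q) = (\<Sum>s\<in>Poly_Mapping.keys p. \<Sum>t\<in>Poly_Mapping.keys q. ?s p s * pdiff i (?s q t))
     + (\<Sum>s\<in>Poly_Mapping.keys p. \<Sum>t\<in>Poly_Mapping.keys q. ?s q t * pdiff i (?s p s))"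
    unfolding e pdiff_sum pdiff_mult_single by (simp add: sum.distrib)
  also have "(\<Sum>s\<in>Poly_Mapping.keys p. \<Sum>t\<in>Poly_Mapping.keys q. ?s q t * pdiff i (?s p s))
     = (\<Sum>t\<in>Poly_Mapping.keys q. \<Sum>s\<in>Poly_Mapping.keys p. ?s q t * pdiff i (?s p s))"
    by (rule sum.swap)
  finally show ?thesis
    by (simp only: sum_product[symmetric] pdiff_sum[symmetric] poly_mapping_sum_singles)
qed

lemma mvars_pdiff: "mvars p \<subseteq> V \<Longrightarrow> mvars (pdiff i p) \<subseteq> V"
proof (induction rule: mpoly_induct)
qed (simp_all add: pdiff_pX pdiff_add pdiff_mult mvars_addI mvars_multI)

lemma pdiff_notin_mvars: "i \<notin> mvars p \<Longrightarrow> pdiff i p = 0"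
  by (rule mpoly_induct[of p "mvars p"]) (auto simp: pdiff_pX pdiff_add pdiff_mult)

text \<open>The chain rule. For \<open>F\<close> = f it reads grad(p(f)) = (grad p)(f) J, the link
  between substitution and the Jacobian matrix.\<close>

lemma pdiff_subst:
  fixes p :: "'a::comm_ring_1 mpoly"
  assumes "mvars p \<subseteq> {..<N}"
  shows "pdiff l (subst F p) = (\<Sum>i<N. subst F (pdiff i p) * pdiff l (F i))"
  using assms
proof (induction rule: mpoly_induct)
  case (var i)
  have "(\<Sum>j<N. subst F (pdiff j (pX i)) * pdiff l (F j)) = (\<Sum>j<N. if j = i then pdiff l (F j) else 0)"
    by (rule sum.cong) (auto simp: pdiff_pX)
  then show ?case using var by simp
qed (auto simp: subst_add subst_mult pdiff_add pdiff_mult sum.distrib algebra_simps sum_distrib_left)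

subsection \<open>Multivariate polynomials as polynomials in one variable\<close>

text \<open>Coefficients stay in the full polynomial type; \<open>mvars_coeff_upoly'\<close> records
  that they are free of x_i. Evaluation at x_i recovers the polynomial, see
  \<open>poly_upoly\<close>.\<close>

definition upoly :: "nat \<Rightarrow> 'a::comm_ring_1 mpoly \<Rightarrow> 'a mpoly poly" where
  "upoly i = meval (\<lambda>c. [:pC c:]) (\<lambda>j. if j = i then [:0, 1:] else [:pX j:])"

interpretation upoly_hom: coeff_hom "\<lambda>c::'a::comm_ring_1. [:pC c:]"
  by standard (auto simp: single_add mult_single one_pCons mult.commute)

lemma upoly_0 [simp]: "upoly i 0 = 0"
  and upoly_1 [simp]: "upoly i 1 = 1"
  and upoly_pC [simp]: "upoly i (pC c) = [:pC c:]"
  and upoly_pX: "upoly i (pX j) = (if j = i then [:0, 1:] else [:pX j:])"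
  and upoly_add: "upoly i (p + q) = upoly i p + upoly i q"
  and upoly_mult: "upoly i (p * q) = upoly i p * upoly i q"
  and upoly_power: "upoly i (p ^ k) = upoly i p ^ k"
  unfolding upoly_def
  by (simp_all add: upoly_hom.meval_add upoly_hom.meval_mult upoly_hom.meval_power)

lemma upoly_uminus: "upoly i (- p) = - upoly i p"
  using upoly_add[of i p "- p"] by (simp add: eq_neg_iff_add_eq_0 add.commute)

lemma upoly_diff: "upoly i (p - q) = upoly i p - upoly i q"
  using upoly_add[of i p "- q"] by (simp add: upoly_uminus)

lemma upoly_free: "i \<notin> mvars p \<Longrightarrow> upoly i p = [:p:]"
  by (rule mpoly_induct[of p "mvars p"]) (auto simp: upoly_pX upoly_add upoly_mult)

lemma poly_upoly: "poly (upoly i p) (pX i) = p"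
  by (rule mpoly_induct[of p "mvars p"]) (auto simp: upoly_pX upoly_add upoly_mult)

lemma mvars_coeff_upoly: "mvars p \<subseteq> V \<Longrightarrow> mvars (coeff (upoly i p) d) \<subseteq> V - {i}"
proof (induction arbitrary: d rule: mpoly_induct)
  case (var j)
  then show ?case
    by (cases d; cases "d - 1") (simp_all add: upoly_pX)
next
  case (add p q)
  then show ?case unfolding upoly_add coeff_add by (intro mvars_addI)
next
  case (mult p q)
  then show ?case
    unfolding upoly_mult coeff_mult by (intro mvars_sumI mvars_multI)
qed (simp add: coeff_pCons split: nat.splits)

lemma mvars_coeff_upoly': "i \<notin> mvars (coeff (upoly i p) d)"
  using mvars_coeff_upoly[of p "mvars p" i d] by blast

lemma upoly_eq_0_iff [simp]: "upoly i p = 0 \<longleftrightarrow> p = 0"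
  by (metis poly_0 poly_upoly upoly_0)

lemma upoly_sum_expand: "p = (\<Sum>d\<le>degree (upoly i p). coeff (upoly i p) d * pX i ^ d)"
  by (metis poly_upoly poly_altdef)

section \<open>Degree and leading coefficient in one variable\<close>

definition deg :: "nat \<Rightarrow> 'a::comm_ring_1 mpoly \<Rightarrow> nat" where
  "deg i p = degree (upoly i p)"

definition lc :: "nat \<Rightarrow> 'a::comm_ring_1 mpoly \<Rightarrow> 'a mpoly" where
  "lc i p = lead_coeff (upoly i p)"

lemma deg_0 [simp]: "deg i 0 = 0"
  by (simp add: deg_def)

lemma deg_eq_0_iff: "deg i p = 0 \<longleftrightarrow> i \<notin> mvars p"
proof
  assume "deg i p = 0"
  then obtain c where c: "upoly i p = [:c:]"
    unfolding deg_def by (meson degree_eq_zeroE)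
  then have "p = c" by (metis poly_upoly poly_const_conv)
  then show "i \<notin> mvars p" using mvars_coeff_upoly'[of i p 0] c by simp
qed (simp add: deg_def upoly_free)

lemma mvars_lc: "mvars p \<subseteq> V \<Longrightarrow> mvars (lc i p) \<subseteq> V - {i}"
  unfolding lc_def by (rule mvars_coeff_upoly)

lemma notin_mvars_lc: "i \<notin> mvars (lc i p)"
  unfolding lc_def by (rule mvars_coeff_upoly')

lemma lc_eq_0_iff [simp]: "lc i p = 0 \<longleftrightarrow> p = 0"
  by (simp add: lc_def)

lemma deg_mult:
  fixes p q :: "'a::idom mpoly"
  shows "p \<noteq> 0 \<Longrightarrow> q \<noteq> 0 \<Longrightarrow> deg i (p * q) = deg i p + deg i q"
  by (simp add: deg_def upoly_mult degree_mult_eq)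

lemma lc_mult:
  fixes p q :: "'a::idom mpoly"
  shows "lc i (p * q) = lc i p * lc i q"
  by (simp add: lc_def upoly_mult lead_coeff_mult)

lemma lc_free: "i \<notin> mvars p \<Longrightarrow> lc i p = p"
  by (simp add: lc_def upoly_free)

text \<open>Over a domain the degrees in each variable add in a product, so no variable of a factor
  can cancel.\<close>

lemma mvars_dvd:
  fixes p q :: "'a::idom mpoly"
  assumes "p dvd q" "q \<noteq> 0"
  shows "mvars p \<subseteq> mvars q"
proof
  fix i assume i: "i \<in> mvars p"
  obtain r where r: "q = p * r" using assms(1) by blast
  with assms(2) have "p \<noteq> 0" "r \<noteq> 0" by auto
  then have "deg i q = deg i p + deg i r" by (simp add: r deg_mult)
  with i show "i \<in> mvars q" using deg_eq_0_iff[of i p] deg_eq_0_iff[of i q] by auto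
qed

lemma mpoly_is_unit_iff:
  fixes p :: "'a::field mpoly"
  shows "p dvd 1 \<longleftrightarrow> p \<noteq> 0 \<and> mvars p = {}"
proof
  assume "p dvd 1"
  then show "p \<noteq> 0 \<and> mvars p = {}" using mvars_dvd[of p 1] by auto
next
  assume *: "p \<noteq> 0 \<and> mvars p = {}"
  then obtain c where c: "p = pC c" using mvars_empty_iff by blast
  with * have "c \<noteq> 0" by auto
  then have "p * pC (inverse c) = 1" by (simp add: c mult_single)
  then show "p dvd 1" by (metis dvd_triv_left)
qed

lemma upoly_pdiff: "upoly i (pdiff i p) = pderiv (upoly i p)"
  by (rule mpoly_induct[of p "mvars p"])
     (auto simp: upoly_pX pdiff_pX pdiff_add pdiff_mult upoly_add upoly_mult pderiv_add pderiv_mult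
        pderiv_pCons)

lemma coeff_upoly_pdiff:
  assumes "j \<noteq> i"
  shows "coeff (upoly j (pdiff i p)) d = pdiff i (coeff (upoly j p) d)"
proof -
  have "mvars p \<subseteq> UNIV" by simp
  then show ?thesis
  proof (induction arbitrary: d rule: mpoly_induct)
    case (var k)
    then show ?case using assms
      by (cases d; cases "d - 1") (simp_all add: upoly_pX pdiff_pX)
  next
    case (mult p q)
    have "coeff (upoly j (pdiff i (p * q))) d
        = (\<Sum>k\<le>d. coeff (upoly j p) k * pdiff i (coeff (upoly j q) (d - k)))
        + (\<Sum>k\<le>d. pdiff i (coeff (upoly j p) k) * coeff (upoly j q) (d - k))"
      using mult.IH by (simp add: pdiff_mult upoly_add upoly_mult coeff_mult mult.commute[of q])
    then show ?case
      by (simp add: upoly_mult coeff_mult pdiff_sum pdiff_mult sum.distrib mult.commute)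
  qed (simp_all add: upoly_add pdiff_add coeff_pCons split: nat.splits)
qed

lemma deg_pdiff_le: "j \<noteq> i \<Longrightarrow> deg j (pdiff i p) \<le> deg j p"
  unfolding deg_def by (rule degree_le) (simp add: coeff_upoly_pdiff coeff_eq_0)

lemma deg_pdiff_less:
  fixes p :: "'a::{idom,ring_char_0} mpoly"
  assumes "i \<in> mvars p"
  shows "pdiff i p \<noteq> 0" "deg i (pdiff i p) < deg i p"
proof -
  have "deg i p \<noteq> 0" using assms by (simp add: deg_eq_0_iff)
  then have d: "degree (upoly i p) > 0" by (simp add: deg_def)
  then have "pderiv (upoly i p) \<noteq> 0" by (simp add: pderiv_eq_0_iff)
  then show "pdiff i p \<noteq> 0" by (metis upoly_pdiff upoly_0)
  show "deg i (pdiff i p) < deg i p"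
    using d by (simp add: deg_def upoly_pdiff degree_pderiv)
qed

lemma deg_minus_lead:
  fixes p :: "'a::comm_ring_1 mpoly"
  assumes "deg i p > 0"
  shows "deg i (p - lc i p * pX i ^ deg i p) < deg i p"
    and "upoly i (p - lc i p * pX i ^ deg i p) = upoly i p - monom (lc i p) (deg i p)"
proof -
  let ?p = "p - lc i p * pX i ^ deg i p"
  show eq: "upoly i ?p = upoly i p - monom (lc i p) (deg i p)"
    by (simp add: upoly_diff upoly_mult upoly_power upoly_pX
        upoly_free[OF notin_mvars_lc] monom_altdef)
  have "degree (upoly i ?p) \<le> deg i p"
    unfolding eq by (intro degree_diff_le) (auto simp: deg_def degree_monom_le)
  moreover have "coeff (upoly i ?p) (deg i p) = 0"
    unfolding eq by (simp add: lc_def deg_def)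
  ultimately have "?p = 0 \<or> deg i ?p < deg i p"
    using eq_zero_or_degree_less[of "upoly i ?p"] by (auto simp: deg_def)
  then show "deg i ?p < deg i p" using assms by auto
qed

lemma mvars_minus_lead:
  assumes "mvars p \<subseteq> V" "i \<in> V"
  shows "mvars (p - lc i p * pX i ^ deg i p) \<subseteq> V"
  using assms mvars_lc[OF assms(1), of i] by (intro mvars_diffI mvars_multI mvars_powerI) auto

text \<open>Leading coefficients are not units, hence the multiplier: a power of
  \<open>lc i d\<close>, which is itself free of x_i. The alternative r = 0 covers
  \<open>deg i d = 0\<close>, since \<open>deg i 0\<close> is 0. Keeping \<open>q\<close> and
  \<open>r\<close> within \<open>V\<close> is what later keeps auxiliary polynomials inside
  k[y].\<close>

lemma mpoly_pseudo_div:
  fixes p d :: "'a::idom mpoly"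
  assumes "d \<noteq> 0" "mvars p \<subseteq> V" "mvars d \<subseteq> V"
  shows "\<exists>k q r. lc i d ^ k * p = q * d + r \<and> mvars q \<subseteq> V \<and> mvars r \<subseteq> V \<and>
           (r = 0 \<or> deg i r < deg i d)"
  using assms(2)
proof (induction "deg i p" arbitrary: p rule: less_induct)
  case less
  show ?case
  proof (cases "p = 0 \<or> deg i p < deg i d")
    case True
    then show ?thesis using less.prems by (intro exI[of _ 0] exI[of _ p]) auto
  next
    case False
    define e where "e = deg i p - deg i d"
    define s where "s = lc i p * pX i ^ e"
    define p' where "p' = lc i d * p - s * d"
    \<comment> \<open>For e = 0 the power is 1 and x_i need not belong to \<open>V\<close>;
      otherwise x_i occurs in \<open>p\<close>.\<close>
    have "mvars (pX i ^ e :: 'a mpoly) \<subseteq> V"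
    proof (cases "e = 0")
      case e: False
      then have "deg i p \<noteq> 0" by (simp add: e_def)
      then have "i \<in> V" using deg_eq_0_iff[of i p] less.prems by auto
      then show ?thesis by (intro mvars_powerI) simp
    qed simp
    then have s: "mvars s \<subseteq> V"
      using mvars_lc[OF less.prems, of i] unfolding s_def by (intro mvars_multI) auto
    have p': "mvars p' \<subseteq> V"
      using mvars_lc[OF assms(3), of i] s less.prems assms(3) unfolding p'_def
      by (intro mvars_multI mvars_diffI) auto
    have eq: "upoly i p' = smult (lc i d) (upoly i p) - smult (lc i p) (monom 1 e * upoly i d)"
      by (simp add: p'_def s_def upoly_diff upoly_mult upoly_power upoly_pX
          upoly_free[OF notin_mvars_lc] monom_altdef)
    have "degree (upoly i p') \<le> degree (upoly i p)"
      unfolding eq using False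
      by (intro degree_diff_le order.trans[OF degree_smult_le] order.trans[OF degree_mult_le])
         (auto simp: e_def deg_def degree_monom_eq)
    moreover have "coeff (upoly i p') (degree (upoly i p)) = 0"
      unfolding eq using False by (simp add: coeff_monom_mult e_def deg_def lc_def)
    ultimately have or: "p' = 0 \<or> deg i p' < deg i p"
      using eq_zero_or_degree_less[of "upoly i p'"] by (auto simp: deg_def)
    have "\<exists>k q r. lc i d ^ k * p' = q * d + r \<and> mvars q \<subseteq> V \<and> mvars r \<subseteq> V \<and>
           (r = 0 \<or> deg i r < deg i d)"
      using or
    proof
      assume "p' = 0"
      then show ?thesis by (intro exI[of _ 0]) simp
    qed (use less.hyps p' in blast)
    then obtain k q r where *: "lc i d ^ k * p' = q * d + r" "mvars q \<subseteq> V" "mvars r \<subseteq> V"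
           "r = 0 \<or> deg i r < deg i d" by blast
    have "lc i d ^ Suc k * p = (q + lc i d ^ k * s) * d + r"
      using *(1) by (simp add: p'_def algebra_simps)
    moreover have "mvars (q + lc i d ^ k * s) \<subseteq> V"
      using *(2) s mvars_lc[OF assms(3), of i] by (intro mvars_addI mvars_multI mvars_powerI) auto
    ultimately show ?thesis using *(3,4) by blast
  qed
qed

subsection \<open>Unique factorisation\<close>

text \<open>A size that is additive on products, vanishes exactly on constants and drops strictly
  under differentiation by an occurring variable. It drives the inductions over factors and the
  minimal choices in prime ideals.\<close>

definition sdeg :: "'a::comm_ring_1 mpoly \<Rightarrow> nat" where
  "sdeg p = (\<Sum>i\<in>mvars p. deg i p)"

lemma sdeg_superset: "finite S \<Longrightarrow> mvars p \<subseteq> S \<Longrightarrow> sdeg p = (\<Sum>i\<in>S. deg i p)"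
  unfolding sdeg_def by (intro sum.mono_neutral_left) (auto simp: deg_eq_0_iff)

lemma sdeg_mult:
  fixes p q :: "'a::idom mpoly"
  assumes "p \<noteq> 0" "q \<noteq> 0"
  shows "sdeg (p * q) = sdeg p + sdeg q"
proof -
  let ?S = "mvars p \<union> mvars q"
  have "sdeg u = (\<Sum>i\<in>?S. deg i u)" if "u \<in> {p, q, p * q}" for u
    using that mvars_mult[of p q] by (intro sdeg_superset) auto
  then show ?thesis using assms by (simp add: deg_mult sum.distrib)
qed

lemma sdeg_eq_0_iff: "sdeg p = 0 \<longleftrightarrow> mvars p = {}"
  by (auto simp: sdeg_def deg_eq_0_iff)

lemma sdeg_pdiff_less:
  fixes p :: "'a::{idom,ring_char_0} mpoly"
  assumes "i \<in> mvars p"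
  shows "sdeg (pdiff i p) < sdeg p"
proof -
  have "sdeg (pdiff i p) = (\<Sum>j\<in>mvars p. deg j (pdiff i p))"
    by (intro sdeg_superset mvars_pdiff) auto
  also have "\<dots> < (\<Sum>j\<in>mvars p. deg j p)"
  proof (rule sum_strict_mono_ex1)
    show "\<forall>j\<in>mvars p. deg j (pdiff i p) \<le> deg j p"
      using deg_pdiff_le deg_pdiff_less(2)[OF assms] less_imp_le by metis
    show "\<exists>j\<in>mvars p. deg j (pdiff i p) < deg j p"
      using deg_pdiff_less(2)[OF assms] assms by blast
  qed simp
  finally show ?thesis by (simp add: sdeg_def)
qed

lemma not_unit_mpoly_imp_sdeg:
  fixes p :: "'a::field mpoly"
  shows "p \<noteq> 0 \<Longrightarrow> \<not> p dvd 1 \<Longrightarrow> sdeg p > 0"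
  by (simp add: mpoly_is_unit_iff sdeg_eq_0_iff flip: neq0_conv)

lemma irreducible_mvars:
  fixes p :: "'a::field mpoly"
  shows "irreducible p \<Longrightarrow> mvars p \<noteq> {}"
  by (auto simp: irreducible_def mpoly_is_unit_iff)

lemma irreducible_factor_with_var:
  fixes p :: "'a::field mpoly"
  assumes "p \<noteq> 0" "i \<in> mvars p"
  shows "\<exists>q. irreducible q \<and> q dvd p \<and> i \<in> mvars q"
  using assms
proof (induction "sdeg p" arbitrary: p rule: less_induct)
  case less
  show ?case
  proof (cases "irreducible p")
    case False
    have "\<not> p dvd 1" using less.prems by (auto simp: mpoly_is_unit_iff)
    with False less.prems obtain a b where ab: "p = a * b" "\<not> a dvd 1" "\<not> b dvd 1"
      unfolding irreducible_def by blast
    then have "a \<noteq> 0" "b \<noteq> 0" using less.prems by auto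
    then have "sdeg a < sdeg p" "sdeg b < sdeg p"
      using ab not_unit_mpoly_imp_sdeg by (auto simp: sdeg_mult)
    have "i \<in> mvars a \<union> mvars b"
      using less.prems(2) mvars_mult[of a b] unfolding ab(1) by auto
    then show ?thesis
    proof
      assume "i \<in> mvars a"
      then obtain q where "irreducible q" "q dvd a" "i \<in> mvars q"
        using less.hyps[OF \<open>sdeg a < sdeg p\<close> \<open>a \<noteq> 0\<close>] by auto
      then show ?thesis unfolding ab(1) by (intro exI[of _ q]) simp
    next
      assume "i \<in> mvars b"
      then obtain q where "irreducible q" "q dvd b" "i \<in> mvars q"
        using less.hyps[OF \<open>sdeg b < sdeg p\<close> \<open>b \<noteq> 0\<close>] by auto
      then show ?thesis unfolding ab(1) by (intro exI[of _ q]) simp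
    qed
  qed (use less.prems in auto)
qed

lemma irreducible_factor_exists:
  fixes p :: "'a::field mpoly"
  assumes "p \<noteq> 0" "\<not> p dvd 1"
  shows "\<exists>q. irreducible q \<and> q dvd p"
  using irreducible_factor_with_var[of p] assms by (auto simp: mpoly_is_unit_iff)

text \<open>A Bezout identity over the fraction field of the polynomials free of x_i, with
  denominators cleared. \<open>d\<close> has least x_i-degree among the nonzero combinations of
  \<open>a\<close> and \<open>b\<close>; pseudo-division by \<open>d\<close> leaves a combination of
  smaller degree, hence 0. The multipliers \<open>c\<close> and \<open>c'\<close> are powers of
  \<open>lc i d\<close>.\<close>

lemma minimal_combination:
  fixes a b :: "'a::idom mpoly"
  assumes "a \<noteq> 0" "mvars a \<subseteq> V" "mvars b \<subseteq> V"
  obtains s t d c c' q q' where "d = s * a + t * b" "d \<noteq> 0" "c * a = q * d" "c' * b = q' * d"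
    "c \<noteq> 0" "c' \<noteq> 0" "mvars c \<subseteq> V - {i}" "mvars c' \<subseteq> V - {i}"
    "mvars s \<subseteq> V" "mvars t \<subseteq> V" "mvars d \<subseteq> V"
    "mvars q \<subseteq> V" "mvars q' \<subseteq> V"
proof -
  define I where "I x \<longleftrightarrow> (\<exists>s t. x = s * a + t * b \<and> mvars s \<subseteq> V \<and> mvars t \<subseteq> V)" for x
  have "I a" unfolding I_def by (intro exI[of _ 1] exI[of _ 0]) auto
  have "I b" unfolding I_def by (intro exI[of _ 1] exI[of _ 0]) auto
  have I_comb: "I (u * x - v * y)" if I: "I x" "I y" "mvars u \<subseteq> V" "mvars v \<subseteq> V" for u v x y
  proof -
    obtain s t s' t' where *: "x = s * a + t * b" "mvars s \<subseteq> V" "mvars t \<subseteq> V"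
      "y = s' * a + t' * b" "mvars s' \<subseteq> V" "mvars t' \<subseteq> V"
      using I unfolding I_def by blast
    then have "u * x - v * y = (u * s - v * s') * a + (u * t - v * t') * b"
      by (simp add: algebra_simps)
    moreover have "mvars (u * s - v * s') \<subseteq> V" "mvars (u * t - v * t') \<subseteq> V"
      using * I by (simp_all add: mvars_diffI mvars_multI)
    ultimately show ?thesis unfolding I_def by blast
  qed
  have "\<exists>x. (I x \<and> x \<noteq> 0) \<and> (\<forall>y. I y \<and> y \<noteq> 0 \<longrightarrow> deg i x \<le> deg i y)"
    by (rule ex_has_least_nat) (use \<open>I a\<close> assms(1) in blast)
  then obtain d where d: "I d" "d \<noteq> 0" "\<And>y. I y \<Longrightarrow> y \<noteq> 0 \<Longrightarrow> deg i d \<le> deg i y"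
    by blast
  have I_vars: "mvars x \<subseteq> V" if "I x" for x
    using that assms(2,3) mvars_addI mvars_multI unfolding I_def by metis
  have div: "\<exists>c q. c * x = q * d \<and> c \<noteq> 0 \<and> mvars c \<subseteq> V - {i} \<and> mvars q \<subseteq> V" if Ix: "I x" for x
  proof -
    obtain k q r where *: "lc i d ^ k * x = q * d + r" "mvars q \<subseteq> V" "mvars r \<subseteq> V"
      "r = 0 \<or> deg i r < deg i d"
      using mpoly_pseudo_div[OF d(2) I_vars[OF Ix] I_vars[OF d(1)]] by blast
    have c: "mvars (lc i d ^ k) \<subseteq> V - {i}"
      by (intro mvars_powerI mvars_lc I_vars d)
    have "r = lc i d ^ k * x - q * d" using *(1) by simp
    then have "I r" using I_comb[OF Ix d(1)] c *(2) by blast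
    then have "r = 0" using d(3) *(4) by fastforce
    then show ?thesis using * c d(2) by (intro exI[of _ "lc i d ^ k"] exI[of _ q]) auto
  qed
  obtain s t where "d = s * a + t * b" "mvars s \<subseteq> V" "mvars t \<subseteq> V"
    using d(1) unfolding I_def by blast
  moreover obtain c q where "c * a = q * d" "c \<noteq> 0" "mvars c \<subseteq> V - {i}" "mvars q \<subseteq> V"
    using div[OF \<open>I a\<close>] by blast
  moreover obtain c' q' where "c' * b = q' * d" "c' \<noteq> 0" "mvars c' \<subseteq> V - {i}" "mvars q' \<subseteq> V"
    using div[OF \<open>I b\<close>] by blast
  ultimately show ?thesis using d(2) I_vars[OF d(1)] by (intro that)
qed

section \<open>Gauss's lemma: primeness of irreducibles passes from \<open>W\<close> to
  \<open>W\<close> with x_i adjoined\<close>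

context
  fixes W :: "nat set" and i :: nat
  assumes iW: "i \<notin> W"
    and prime_W: "\<And>p a b :: 'a::field mpoly. irreducible p \<Longrightarrow> mvars p \<subseteq> W \<Longrightarrow> mvars a \<subseteq> W \<Longrightarrow>
      mvars b \<subseteq> W \<Longrightarrow> p dvd a * b \<Longrightarrow> p dvd a \<or> p dvd b"
begin

text \<open>By primeness in \<open>W\<close>, \<open>p\<close> divides the leading coefficient of
  one factor; subtracting that leading term keeps the divisibility and lowers the sum of the
  degrees.\<close>

lemma Gauss_constant:
  fixes p a b :: "'a mpoly"
  assumes "irreducible p" "mvars p \<subseteq> W"
  shows "mvars a \<subseteq> insert i W \<Longrightarrow> mvars b \<subseteq> insert i W \<Longrightarrow> p dvd a * b \<Longrightarrow> p dvd a \<or> p dvd b"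
proof (induction "deg i a + deg i b" arbitrary: a b rule: less_induct)
  case less
  have step: "p dvd x \<or> p dvd y" if xy: "mvars x \<subseteq> insert i W" "mvars y \<subseteq> insert i W" "p dvd x * y"
    "p dvd lc i x" "x \<noteq> 0" "deg i x + deg i y = deg i a + deg i b" for x y
  proof (cases "deg i x = 0")
    case True
    then have "lc i x = x" by (simp add: deg_eq_0_iff lc_free)
    then show ?thesis using that by simp
  next
    case False
    define x' where "x' = x - lc i x * pX i ^ deg i x"
    have small: "deg i x' < deg i x" unfolding x'_def using False by (intro deg_minus_lead) simp
    have "mvars x' \<subseteq> insert i W" unfolding x'_def using xy(1) by (intro mvars_minus_lead) auto
    moreover have "p dvd x' * y"
      unfolding x'_def left_diff_distrib using that by (intro dvd_diff) auto
    ultimately have "p dvd x' \<or> p dvd y"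
      using less.hyps[of x' y] xy small by linarith
    moreover have "p dvd x" if "p dvd x'"
    proof -
      have "p dvd x' + lc i x * pX i ^ deg i x" using that xy(4) by (intro dvd_add) auto
      then show ?thesis by (simp add: x'_def)
    qed
    ultimately show ?thesis by blast
  qed
  show ?case
  proof (cases "a = 0 \<or> b = 0")
    case False
    have p: "lc i p = p" using assms(2) iW by (intro lc_free) auto
    obtain e where "a * b = p * e" using less.prems by blast
    then have "lc i a * lc i b = p * lc i e" by (metis lc_mult p)
    then have "p dvd lc i a * lc i b" by simp
    moreover have "mvars (lc i a) \<subseteq> W" "mvars (lc i b) \<subseteq> W"
      using mvars_lc[OF less.prems(1), of i] mvars_lc[OF less.prems(2), of i] by auto
    ultimately have "p dvd lc i a \<or> p dvd lc i b"
      using prime_W[OF assms] by blast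
    then show ?thesis
      using step[of a b] step[of b a] less.prems False by (auto simp: mult.commute add.commute)
  qed auto
qed

text \<open>An irreducible \<open>p\<close> containing x_i is primitive. In c * a = p * e each prime
  factor of \<open>c\<close> is free of x_i, so it cannot be associated to \<open>p\<close>; it
  divides \<open>e\<close> and is cancelled.\<close>

lemma Gauss_cancel:
  fixes p a c :: "'a mpoly"
  assumes p: "irreducible p" "i \<in> mvars p" "mvars p \<subseteq> insert i W"
  shows "p dvd c * a \<Longrightarrow> c \<noteq> 0 \<Longrightarrow> mvars c \<subseteq> W \<Longrightarrow> mvars a \<subseteq> insert i W \<Longrightarrow> p dvd a"
proof (induction "sdeg c" arbitrary: c rule: less_induct)
  case less
  show ?case
  proof (cases "a = 0 \<or> c dvd 1")
    case True
    then show ?thesis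
    proof
      assume "c dvd 1"
      then obtain c' where "1 = c * c'" by blast
      then have "a = c' * (c * a)" by (simp add: mult_ac)
      then show ?thesis using less.prems(1) by (metis dvd_mult)
    qed simp
  next
    case False
    then obtain \<pi> where \<pi>: "irreducible \<pi>" "\<pi> dvd c"
      using irreducible_factor_exists less.prems by blast
    obtain c1 where c1: "c = \<pi> * c1" using \<pi> by blast
    obtain e where e: "c * a = p * e" using less.prems by blast
    have \<pi>W: "mvars \<pi> \<subseteq> W" using mvars_dvd[OF \<pi>(2)] less.prems by auto
    have "mvars e \<subseteq> mvars (c * a)"
      using False less.prems(2) by (intro mvars_dvd) (metis dvd_triv_right e, simp)
    then have "mvars e \<subseteq> insert i W" using less.prems mvars_mult[of c a] by blast
    moreover have "\<pi> dvd p * e" using e c1 by (metis dvd_triv_left mult.assoc)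
    ultimately have "\<pi> dvd p \<or> \<pi> dvd e"
      using Gauss_constant[OF \<pi>(1) \<pi>W] p by blast
    moreover have "\<not> \<pi> dvd p"
    proof
      assume "\<pi> dvd p"
      then obtain y where y: "p = \<pi> * y" by blast
      then have "y dvd 1" using p(1) \<pi>(1) unfolding irreducible_def by blast
      then have "mvars p \<subseteq> mvars \<pi>"
        using mvars_mult[of \<pi> y] y by (auto simp: mpoly_is_unit_iff)
      then show False using p(2) \<pi>W iW by blast
    qed
    ultimately obtain e1 where "e = \<pi> * e1" by blast
    then have "\<pi> * (c1 * a) = \<pi> * (p * e1)" using e c1 by (simp add: mult_ac)
    moreover have "\<pi> \<noteq> 0" "c1 \<noteq> 0" using c1 less.prems by auto
    ultimately have "p dvd c1 * a" by simp
    moreover have "sdeg c1 < sdeg c"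
      using \<pi>(1) \<open>\<pi> \<noteq> 0\<close> \<open>c1 \<noteq> 0\<close> not_unit_mpoly_imp_sdeg[of \<pi>] c1
      by (simp add: sdeg_mult irreducible_def)
    moreover have "mvars c1 \<subseteq> W" using mvars_dvd[of c1 c] c1 less.prems by auto
    ultimately show ?thesis using less.hyps \<open>c1 \<noteq> 0\<close> less.prems by blast
  qed
qed

text \<open>\<open>p\<close> stays irreducible when denominators free of x_i are allowed: each prime
  factor of \<open>c\<close> divides \<open>q\<close> or \<open>d\<close> by
  \<open>Gauss_constant\<close> and is cancelled there, until \<open>c\<close> is a unit.\<close>

lemma Gauss_factor:
  fixes p q d c :: "'a mpoly"
  assumes p: "irreducible p"
  shows "c * p = q * d \<Longrightarrow> c \<noteq> 0 \<Longrightarrow> mvars c \<subseteq> W \<Longrightarrow> mvars q \<subseteq> insert i W \<Longrightarrow>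
    mvars d \<subseteq> insert i W \<Longrightarrow> p dvd q \<or> p dvd d"
proof (induction "sdeg c" arbitrary: c q d rule: less_induct)
  case less
  show ?case
  proof (cases "c dvd 1")
    case True
    then obtain c' where c': "1 = c * c'" by blast
    have "p = (c * c') * p" by (simp flip: c')
    also have "\<dots> = c' * (c * p)" by (simp add: mult_ac)
    also have "\<dots> = (c' * q) * d" by (simp add: less.prems(1) mult_ac)
    finally have pe: "p = (c' * q) * d" .
    then have "(c' * q) dvd 1 \<or> d dvd 1" using p unfolding irreducible_def by blast
    then show ?thesis
    proof
      assume "(c' * q) dvd 1"
      then obtain z where z: "1 = c' * q * z" by blast
      have "d = (c' * q * z) * d" by (simp flip: z)
      also have "\<dots> = (c' * q * d) * z" by (simp add: mult_ac)
      finally show ?thesis by (metis pe dvd_triv_left)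
    next
      assume "d dvd 1"
      then obtain z where z: "1 = d * z" by blast
      have "q = (d * z) * ((c * c') * q)" by (simp flip: z c')
      also have "\<dots> = (c' * q * d) * (z * c)" by (simp add: mult_ac)
      finally show ?thesis by (metis pe dvd_triv_left)
    qed
  next
    case False
    then obtain \<pi> where \<pi>: "irreducible \<pi>" "\<pi> dvd c"
      using irreducible_factor_exists less.prems by blast
    obtain c1 where c1: "c = \<pi> * c1" using \<pi> by blast
    have \<pi>W: "mvars \<pi> \<subseteq> W" using mvars_dvd[OF \<pi>(2)] less.prems by auto
    have nz: "\<pi> \<noteq> 0" "c1 \<noteq> 0" "p \<noteq> 0" using c1 less.prems p by (auto simp: irreducible_def)
    then have nz': "q \<noteq> 0" "d \<noteq> 0" using less.prems by auto
    have "\<pi> dvd q * d" using less.prems(1) c1 by (metis dvd_triv_left mult.assoc)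
    then have "\<pi> dvd q \<or> \<pi> dvd d"
      using Gauss_constant[OF \<pi>(1) \<pi>W] less.prems by blast
    moreover have small: "sdeg c1 < sdeg c" "mvars c1 \<subseteq> W"
      using \<pi>(1) nz not_unit_mpoly_imp_sdeg[of \<pi>] c1 mvars_dvd[of c1 c] less.prems
      by (auto simp: sdeg_mult irreducible_def)
    moreover have "p dvd q \<or> p dvd d" if "q = \<pi> * x" for x
    proof -
      have "c1 * p = x * d" using less.prems(1) c1 that nz by (simp add: mult_ac)
      moreover have "mvars x \<subseteq> insert i W" using mvars_dvd[of x q] nz' less.prems that by auto
      ultimately have "p dvd x \<or> p dvd d"
        using less.hyps[OF small(1) _ nz(2) small(2)] less.prems by blast
      then show ?thesis using that by auto
    qed
    moreover have "p dvd q \<or> p dvd d" if "d = \<pi> * x" for x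
    proof -
      have "\<pi> * (c1 * p) = \<pi> * (q * x)" using less.prems(1) c1 that by (simp add: mult_ac)
      then have "c1 * p = q * x" using nz by simp
      moreover have "mvars x \<subseteq> insert i W" using mvars_dvd[of x d] nz' less.prems that by auto
      ultimately have "p dvd q \<or> p dvd x"
        using less.hyps[OF small(1) _ nz(2) small(2)] less.prems by blast
      then show ?thesis using that by auto
    qed
    ultimately show ?thesis by blast
  qed
qed

lemma Gauss_step:
  fixes p a b :: "'a mpoly"
  assumes p: "irreducible p" "mvars p \<subseteq> insert i W" and a: "mvars a \<subseteq> insert i W"
    and b: "mvars b \<subseteq> insert i W" and "p dvd a * b"
  shows "p dvd a \<or> p dvd b"
proof (cases "i \<in> mvars p")
  case False
  then show ?thesis using Gauss_constant[OF p(1) _ a b] p(2) assms(5) by blast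
next
  case True
  have "p \<noteq> 0" using p(1) by auto
  obtain s t d c c' q q' where *: "d = s * p + t * a" "d \<noteq> 0" "c * p = q * d" "c' * a = q' * d"
    "c \<noteq> 0" "c' \<noteq> 0" "mvars c \<subseteq> insert i W - {i}" "mvars c' \<subseteq> insert i W - {i}"
    "mvars s \<subseteq> insert i W" "mvars t \<subseteq> insert i W" "mvars d \<subseteq> insert i W"
    "mvars q \<subseteq> insert i W" "mvars q' \<subseteq> insert i W"
    by (rule minimal_combination[OF \<open>p \<noteq> 0\<close> p(2) a])
  have cW: "mvars c \<subseteq> W" "mvars c' \<subseteq> W" using * by auto
  \<comment> \<open>If p divides \<open>q\<close>, then \<open>d\<close> divides \<open>c\<close>
    and is free of x_i, and p divides d * b because it divides both p and a * b. If p divides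
    \<open>d\<close>, then it divides c' * a. In either case \<open>Gauss_cancel\<close> removes the
    multiplier.\<close>
  from Gauss_factor[OF p(1) *(3,5) cW(1) *(12,11)] show ?thesis
  proof
    assume "p dvd q"
    then obtain z where "q = p * z" by blast
    then have "c = d * z" using *(3) \<open>p \<noteq> 0\<close> by (simp add: mult_ac)
    then have "mvars d \<subseteq> W" using mvars_dvd[of d c] *(5) cW by auto
    moreover have "p dvd d * b"
      using assms(5) by (simp add: *(1) distrib_right mult.assoc)
    ultimately show ?thesis
      using Gauss_cancel[OF p(1) True p(2)] *(2) b by blast
  next
    assume "p dvd d"
    then have "p dvd c' * a" using *(4) by simp
    then show ?thesis using Gauss_cancel[OF p(1) True p(2)] *(6) cW a by blast
  qed
qed

end

theorem irreducible_mpoly_imp_prime_elem: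
  fixes p :: "'a::field mpoly"
  assumes "irreducible p"
  shows "prime_elem p"
proof -
  have main: "irreducible p \<Longrightarrow> mvars p \<subseteq> {..<n} \<Longrightarrow> mvars a \<subseteq> {..<n} \<Longrightarrow> mvars b \<subseteq> {..<n} \<Longrightarrow>
    p dvd a * b \<Longrightarrow> p dvd a \<or> p dvd b" for n and p a b :: "'a mpoly"
  proof (induction n arbitrary: p a b)
    case 0
    then show ?case using irreducible_mvars by auto
  next
    case (Suc n)
    show ?case
      by (rule Gauss_step[of n "{..<n}"]) (use Suc in \<open>auto simp: lessThan_Suc\<close>)
  qed
  show ?thesis
  proof (rule prime_elemI)
    fix a b assume ab: "p dvd a * b"
    have "finite (mvars p \<union> mvars a \<union> mvars b)" by simp
    then obtain n where "mvars p \<union> mvars a \<union> mvars b \<subseteq> {..<n}"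
      using finite_nat_iff_bounded by blast
    then show "p dvd a \<or> p dvd b" using main[OF assms, of n a b] ab by simp
  qed (use assms in \<open>auto simp: irreducible_def\<close>)
qed

subsection \<open>Common divisors, elimination and irreducibility\<close>

lemma mpoly_prime_induct [consumes 1, case_names unit prime]:
  fixes p :: "'a::field mpoly"
  assumes "p \<noteq> 0"
    and "\<And>p. p dvd 1 \<Longrightarrow> P p"
    and "\<And>p q. prime_elem p \<Longrightarrow> q \<noteq> 0 \<Longrightarrow> P q \<Longrightarrow> P (p * q)"
  shows "P p"
  using assms(1)
proof (induction "sdeg p" arbitrary: p rule: less_induct)
  case less
  show ?case
  proof (cases "p dvd 1")
    case False
    then obtain \<pi> q where *: "irreducible \<pi>" "p = \<pi> * q"
      using irreducible_factor_exists less.prems by blast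
    then have "\<pi> \<noteq> 0" "q \<noteq> 0" "\<not> \<pi> dvd 1" using less.prems by (auto simp: irreducible_def)
    then have "sdeg q < sdeg p" using not_unit_mpoly_imp_sdeg[of \<pi>] *(2) by (simp add: sdeg_mult)
    then show ?thesis
      using less.hyps \<open>q \<noteq> 0\<close> assms(3) irreducible_mpoly_imp_prime_elem[OF *(1)] *(2) by blast
  qed (use assms(2) in blast)
qed

text \<open>Ensures that the choice in \<open>dgcd\<close> is a genuine gcd. Unless \<open>A\<close>
  has no nonzero element, a common divisor \<open>d\<close> of largest \<open>sdeg\<close> works:
  for a prime p, d * p is too large to divide all of \<open>A\<close>, so p misses some quotient
  a/d, and when p * e is a common divisor, primeness pushes p into d/e.\<close>

lemma mpoly_is_gcd_of_exists:
  fixes A :: "'a::field mpoly set"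
  shows "\<exists>d. is_gcd_of A d"
proof (cases "A \<subseteq> {0}")
  case True
  then show ?thesis unfolding is_gcd_of_def by (intro exI[of _ 0]) auto
next
  case False
  then obtain a0 where a0: "a0 \<in> A" "a0 \<noteq> 0" by blast
  define cd where "cd d \<longleftrightarrow> (\<forall>a\<in>A. d dvd a)" for d
  have "\<exists>d. cd d \<and> (\<forall>y. cd y \<longrightarrow> sdeg y \<le> sdeg d)"
  proof (rule ex_has_greatest_nat[of cd 1 sdeg "Suc (sdeg a0)"])
    show "cd 1" by (simp add: cd_def)
    show "\<forall>y. cd y \<longrightarrow> sdeg y < Suc (sdeg a0)"
    proof safe
      fix y assume "cd y"
      then obtain z where "a0 = y * z" using a0 unfolding cd_def by blast
      then show "sdeg y < Suc (sdeg a0)" using a0 by (auto simp: sdeg_mult)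
    qed
  qed
  then obtain d where d: "cd d" "\<And>y. cd y \<Longrightarrow> sdeg y \<le> sdeg d" by blast
  have "d \<noteq> 0" using d(1) a0 unfolding cd_def by auto
  have "e dvd d" if "cd e" for e
  proof -
    have "e \<noteq> 0" using that a0 unfolding cd_def by auto
    then show ?thesis using that
    proof (induction e rule: mpoly_prime_induct)
      case (unit e)
      then show ?case using dvd_trans one_dvd by blast
    next
      case (prime p e)
      have "cd e" using prime.prems unfolding cd_def by (metis dvd_mult_right)
      then obtain d2 where d2: "d = e * d2" using prime by blast
      have "p \<noteq> 0" "\<not> p dvd 1" using prime(1) by (auto simp: prime_elem_def)
      then have "sdeg (d * p) > sdeg d"
        using \<open>d \<noteq> 0\<close> not_unit_mpoly_imp_sdeg[of p] by (simp add: sdeg_mult)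
      then have "\<not> cd (d * p)" using d(2)[of "d * p"] by auto
      then obtain a where a: "a \<in> A" "\<not> d * p dvd a" unfolding cd_def by blast
      obtain a' where a': "a = d * a'" using a d(1) unfolding cd_def by blast
      have "\<not> p dvd a'" using a(2) \<open>d \<noteq> 0\<close> by (simp add: a')
      moreover have "p * e dvd e * (d2 * a')"
        using prime.prems a(1) unfolding cd_def by (simp add: a' d2 mult.assoc)
      then have "p dvd d2 * a'" using prime(2) by (simp add: mult.commute[of p])
      ultimately have "p dvd d2" using prime_elem_dvd_multD[OF prime(1)] by blast
      then show ?case by (simp add: d2 mult.commute[of p])
    qed
  qed
  then show ?thesis using d(1) unfolding is_gcd_of_def cd_def by blast
qed

lemma dvd_dgcd_iff:
  fixes f :: "nat \<Rightarrow> 'a::field mpoly"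
  shows "g dvd dgcd n m f \<longleftrightarrow> (\<forall>\<Delta>\<in>jac_minors n m f. g dvd \<Delta>)"
proof -
  have "is_gcd_of (jac_minors n m f) (dgcd n m f)"
    unfolding dgcd_def by (rule someI_ex[OF mpoly_is_gcd_of_exists])
  then show ?thesis unfolding is_gcd_of_def by (meson dvd_trans)
qed

text \<open>Plays the role of a resultant. A prime factor of the minimal combination that contains
  x_i cannot divide the multipliers, which are free of x_i, so it would divide both \<open>a\<close>
  and \<open>b\<close>.\<close>

lemma eliminate_variable:
  fixes a b :: "'a::field mpoly"
  assumes "a \<noteq> 0" "mvars a \<subseteq> V" "mvars b \<subseteq> V"
    and coprime: "\<And>\<pi>. irreducible \<pi> \<Longrightarrow> i \<in> mvars \<pi> \<Longrightarrow> \<pi> dvd a \<Longrightarrow> \<pi> dvd b \<Longrightarrow> False"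
  shows "\<exists>s t. s * a + t * b \<noteq> 0 \<and> mvars (s * a + t * b) \<subseteq> V - {i}"
proof -
  obtain s t d c c' q q' where *: "d = s * a + t * b" "d \<noteq> 0" "c * a = q * d" "c' * b = q' * d"
    "c \<noteq> 0" "c' \<noteq> 0" "mvars c \<subseteq> V - {i}" "mvars c' \<subseteq> V - {i}"
    "mvars s \<subseteq> V" "mvars t \<subseteq> V" "mvars d \<subseteq> V" "mvars q \<subseteq> V" "mvars q' \<subseteq> V"
    by (rule minimal_combination[OF assms(1-3)])
  have "i \<notin> mvars d"
  proof
    assume "i \<in> mvars d"
    then obtain \<pi> where \<pi>: "irreducible \<pi>" "\<pi> dvd d" "i \<in> mvars \<pi>"
      using irreducible_factor_with_var *(2) by blast
    have "\<not> \<pi> dvd c" "\<not> \<pi> dvd c'"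
      using mvars_dvd[of \<pi>] \<pi>(3) *(5-8) by blast+
    moreover have "\<pi> dvd c * a" "\<pi> dvd c' * b" using \<pi>(2) *(3,4) by auto
    ultimately have "\<pi> dvd a" "\<pi> dvd b"
      using prime_elem_dvd_multD[OF irreducible_mpoly_imp_prime_elem[OF \<pi>(1)]] by blast+
    then show False using coprime \<pi> by blast
  qed
  then have "mvars d \<subseteq> V - {i}" using *(11) by blast
  then show ?thesis using *(1,2) by blast
qed

text \<open>With w = pi v the product rule gives pi | v (d_i pi). In characteristic zero d_i pi is
  nonzero of smaller x_i-degree than pi, so pi | v and pi^2 | w.\<close>

lemma squarefree_pdiff_coprime:
  fixes w \<pi> :: "'a::field_char_0 mpoly"
  assumes "squarefree w" "irreducible \<pi>" "i \<in> mvars \<pi>" "\<pi> dvd w" "\<pi> dvd pdiff i w"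
  shows False
proof -
  obtain v where v: "w = \<pi> * v" using assms by blast
  have prime: "prime_elem \<pi>" using irreducible_mpoly_imp_prime_elem assms by blast
  have "\<pi> dvd \<pi> * pdiff i v + v * pdiff i \<pi>" using assms(5) by (simp add: v pdiff_mult)
  then have "\<pi> dvd v * pdiff i \<pi>" by (simp add: dvd_add_right_iff)
  moreover have "\<not> \<pi> dvd pdiff i \<pi>"
  proof
    assume "\<pi> dvd pdiff i \<pi>"
    then obtain z where z: "pdiff i \<pi> = \<pi> * z" by blast
    with deg_pdiff_less[OF assms(3)] show False by (auto simp: z deg_mult)
  qed
  ultimately have "\<pi> dvd v" using prime_elem_dvd_multD[OF prime] by blast
  then have "\<pi>\<^sup>2 dvd w" by (auto simp: v power2_eq_square)
  then show False using assms(1,2) by (auto simp: squarefree_def irreducible_def)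
qed

lemma irreducible_imp_squarefree:
  fixes w :: "'a::comm_semiring_1"
  assumes "irreducible w"
  shows "squarefree w"
  unfolding squarefree_def
proof safe
  fix x assume "x\<^sup>2 dvd w"
  then obtain y where "w = x * (x * y)" by (auto simp: power2_eq_square mult.assoc)
  then have "x dvd 1 \<or> x * y dvd 1" using assms unfolding irreducible_def by blast
  then show "x dvd 1" using dvd_mult_left by blast
qed

text \<open>Only a statement about degrees: over a coefficient domain a non-unit constant factor is
  not excluded and is treated separately where the criterion is applied.\<close>

lemma Eisenstein:
  fixes p a b :: "'a::idom poly"
  assumes prime: "prime_elem \<pi>" and p: "p = a * b"
    and lead: "\<not> \<pi> dvd lead_coeff p" and low: "\<And>t. t < degree p \<Longrightarrow> \<pi> dvd coeff p t"
    and const: "\<not> \<pi>\<^sup>2 dvd coeff p 0"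
  shows "degree a = 0 \<or> degree b = 0"
proof (rule ccontr)
  assume deg: "\<not> (degree a = 0 \<or> degree b = 0)"
  have lead_ab: "\<not> \<pi> dvd lead_coeff a" "\<not> \<pi> dvd lead_coeff b"
    using lead by (auto simp: p lead_coeff_mult)
  \<comment> \<open>\<open>x\<close> is the factor whose constant coefficient is divisible by pi.
    Its first coefficient not divisible by pi sits at some t <= degree x < degree p, and there the
    product formula leaves a single term to contradict primeness.\<close>
  have *: False if xy: "\<pi> dvd coeff x 0" "\<not> \<pi> dvd coeff y 0" "p = x * y" "\<not> \<pi> dvd lead_coeff x"
    "degree x < degree p" for x y
  proof -
    define t where "t = (LEAST t. \<not> \<pi> dvd coeff x t)"
    have t: "\<not> \<pi> dvd coeff x t" unfolding t_def by (rule LeastI) (rule xy(4))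
    have t': "\<pi> dvd coeff x s" if "s < t" for s
      using not_less_Least that unfolding t_def by blast
    have "t \<le> degree x" unfolding t_def by (rule Least_le) (rule xy(4))
    then have "\<pi> dvd coeff p t" using low xy(5) by simp
    moreover have "coeff p t = coeff x t * coeff y 0 + (\<Sum>s<t. coeff x s * coeff y (t - s))"
      by (simp add: xy(3) coeff_mult lessThan_Suc_atMost[symmetric])
    moreover have "\<pi> dvd (\<Sum>s<t. coeff x s * coeff y (t - s))"
      by (intro dvd_sum) (simp add: t')
    ultimately have "\<pi> dvd coeff x t * coeff y 0" by (simp add: dvd_add_left_iff)
    then show False using prime_elem_dvd_multD[OF prime] t xy(2) by blast
  qed
  have nz: "a \<noteq> 0" "b \<noteq> 0" using lead_ab by auto
  then have dp: "degree p = degree a + degree b" by (simp add: p degree_mult_eq)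
  then have "\<pi> dvd coeff p 0" using low[of 0] deg by simp
  then have "\<pi> dvd coeff a 0 * coeff b 0" by (simp add: p coeff_mult)
  then have "\<pi> dvd coeff a 0 \<or> \<pi> dvd coeff b 0" using prime_elem_dvd_multD[OF prime] by blast
  moreover have "\<not> (\<pi> dvd coeff a 0 \<and> \<pi> dvd coeff b 0)"
    using const by (auto simp: p coeff_mult power2_eq_square mult_dvd_mono)
  ultimately show False
    using *[of a b] *[of b a] lead_ab dp deg by (auto simp: p mult.commute)
qed

text \<open>Degree one in x_j with leading coefficient 1 leaves only a unit as factor of degree 0.
  The shifts by different \<open>c\<close> supply a prime avoiding a given irreducible
  polynomial.\<close>

lemma irreducible_pX_add:
  fixes c :: "'a::field"
  shows "irreducible (pX j + pC c)"
proof -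
  have U: "upoly j (pX j + pC c) = [:pC c, 1:]"
    by (simp add: upoly_add upoly_pX)
  then have d: "deg j (pX j + pC c) = 1" and l: "lc j (pX j + pC c) = 1"
    by (simp_all add: deg_def lc_def)
  have "pX j + pC c \<noteq> 0" using d by auto
  moreover have "\<not> pX j + pC c dvd 1" using d deg_eq_0_iff[of j "pX j + pC c"] by (auto simp: mpoly_is_unit_iff)
  moreover have "a dvd 1 \<or> b dvd 1" if "pX j + pC c = a * b" for a b
  proof -
    have "a \<noteq> 0" "b \<noteq> 0" using that \<open>pX j + pC c \<noteq> 0\<close> by auto
    then have "deg j a + deg j b = 1" using d by (simp add: that deg_mult)
    then have "deg j a = 0 \<or> deg j b = 0" by auto
    moreover have "lc j a * lc j b = 1" using l by (simp add: that lc_mult)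
    ultimately show ?thesis
      by (metis deg_eq_0_iff dvd_triv_left dvd_triv_right lc_free)
  qed
  ultimately show ?thesis unfolding irreducible_def by blast
qed

lemma mvars_pX_add: "mvars (pX j + pC (c::'a::field)) = {j}"
proof -
  have "mvars (pX j + pC c) \<subseteq> {j}" by (intro mvars_addI) auto
  moreover have "mvars (pX j + pC c) \<noteq> {}" by (rule irreducible_mvars[OF irreducible_pX_add])
  ultimately show ?thesis by blast
qed

lemma irreducible_dvd_irreducible:
  fixes p q :: "'a::comm_semiring_1"
  assumes "irreducible p" "irreducible q" "p dvd q"
  shows "q dvd p"
proof -
  obtain y where y: "q = p * y" using assms by blast
  then have "y dvd 1" using assms unfolding irreducible_def by blast
  then obtain z where z: "1 = y * z" by blast
  have "p = p * (y * z)" by (simp flip: z)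
  also have "\<dots> = q * z" by (simp add: y mult.assoc)
  finally show ?thesis by (metis dvd_triv_left)
qed

text \<open>The high power of \<open>x\<^sub>i\<close> and the auxiliary prime \<open>\<pi>\<close> are there to make the polynomial satisfy
  Eisenstein's criterion while keeping it in the ideal generated by \<open>h\<^sup>2\<close> and \<open>r\<^sup>2\<close>.\<close>

lemma irreducible_combination_of_squares:
  fixes h r \<pi> :: "'a::field mpoly"
  assumes h: "irreducible h" "i \<in> mvars h"
    and r: "irreducible r" "i \<notin> mvars r"
    and \<pi>: "irreducible \<pi>" "i \<notin> mvars \<pi>" "\<not> \<pi> dvd r"
  defines "w \<equiv> r\<^sup>2 * (pX i ^ Suc (2 * deg i h) + \<pi>) + \<pi>\<^sup>2 * h\<^sup>2"
  shows "irreducible w"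
proof -
  \<comment> \<open>Larger than the x_i-degree of \<open>h\<^sup>2\<close>, so the leading
    coefficient of \<open>w\<close> is \<open>r\<^sup>2\<close>.\<close>
  define N where "N = Suc (2 * deg i h)"
  have primes: "prime_elem h" "prime_elem r" "prime_elem \<pi>"
    using irreducible_mpoly_imp_prime_elem h r \<pi> by auto
  have nz: "h \<noteq> 0" "r \<noteq> 0" "\<pi> \<noteq> 0" using h r \<pi> by auto
  define H where "H = upoly i h"
  have fr: "upoly i (r\<^sup>2) = [:r\<^sup>2:]" "upoly i (\<pi>\<^sup>2) = [:\<pi>\<^sup>2:]" "upoly i \<pi> = [:\<pi>:]"
    using r \<pi> mvars_powerI[of r "- {i}" 2] mvars_powerI[of \<pi> "- {i}" 2]
    by (auto intro!: upoly_free)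
  have Xpow: "upoly i (pX i ^ k) = monom 1 k" for k
    by (simp add: upoly_power upoly_pX monom_altdef)
  have U: "upoly i w = monom (r\<^sup>2) N + [:r\<^sup>2 * \<pi>:] + smult (\<pi>\<^sup>2) (H\<^sup>2)"
  proof -
    have "upoly i w = [:r\<^sup>2:] * (monom 1 N + [:\<pi>:]) + [:\<pi>\<^sup>2:] * H\<^sup>2"
      unfolding w_def N_def H_def upoly_add upoly_mult fr Xpow by (simp add: upoly_power)
    then show ?thesis by (simp add: distrib_left smult_monom)
  qed
  have degH: "degree (H\<^sup>2) < N"
    by (simp add: N_def H_def deg_def power2_eq_square degree_mult_le le_imp_less_Suc mult_2)
  then have cH: "coeff (H\<^sup>2) t = 0" if "t \<ge> N" for t using that by (intro coeff_eq_0) simp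
  have N: "N > 0" by (simp add: N_def)
  have coeff_w: "coeff (upoly i w) t = (if t = N then r\<^sup>2 else 0) + (if t = 0 then r\<^sup>2 * \<pi> else 0)
    + \<pi>\<^sup>2 * coeff (H\<^sup>2) t" for t
    by (auto simp: U coeff_pCons split: nat.splits)
  have "degree (upoly i w) \<le> N"
    by (rule degree_le) (use cH coeff_w N in auto)
  moreover have lead: "coeff (upoly i w) N = r\<^sup>2" using coeff_w[of N] N cH by simp
  ultimately have deg_w: "degree (upoly i w) = N"
    using nz by (metis le_antisym le_degree power_not_zero)
  \<comment> \<open>The bracket is \<open>r\<^sup>2\<close> modulo pi, so pi divides the constant
    coefficient exactly once.\<close>
  have const: "coeff (upoly i w) 0 = \<pi> * (r\<^sup>2 + \<pi> * coeff (H\<^sup>2) 0)"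
    using coeff_w[of 0] N by (simp add: algebra_simps power2_eq_square)
  have not_dvd: "\<not> \<pi> dvd r\<^sup>2" using \<pi>(3) prime_elem_dvd_power[OF primes(3)] by blast
  have eis: "degree (upoly i a) = 0 \<or> degree (upoly i b) = 0" if "w = a * b" for a b
  proof (rule Eisenstein[OF primes(3)])
    show "upoly i w = upoly i a * upoly i b" by (simp add: that upoly_mult)
    show "\<not> \<pi> dvd lead_coeff (upoly i w)" using not_dvd by (simp add: deg_w lead)
    show "\<pi> dvd coeff (upoly i w) t" if "t < degree (upoly i w)" for t
      using that by (auto simp: coeff_w deg_w power2_eq_square)
    have "\<not> \<pi> dvd r\<^sup>2 + \<pi> * coeff (H\<^sup>2) 0" using not_dvd by (simp add: dvd_add_left_iff)
    then show "\<not> \<pi>\<^sup>2 dvd coeff (upoly i w) 0" using nz by (simp add: const power2_eq_square)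
  qed
  \<comment> \<open>A factor free of x_i divides the leading coefficient \<open>r\<^sup>2\<close>,
    so its prime factors are associated to \<open>r\<close>, and r divides pi^2 h^2. Association
    with pi contradicts that pi does not divide r; association with h fails because only h contains
    x_i.\<close>
  have content: "a dvd 1" if ab: "w = a * b" and a: "degree (upoly i a) = 0" for a b
  proof (rule ccontr)
    assume "\<not> a dvd 1"
    have ia: "i \<notin> mvars a" using a deg_eq_0_iff deg_def by metis
    have "w \<noteq> 0" using deg_w N by auto
    then have "a \<noteq> 0" using ab by auto
    then obtain \<rho> where \<rho>: "irreducible \<rho>" "\<rho> dvd a"
      using irreducible_factor_exists \<open>\<not> a dvd 1\<close> by blast
    have "lc i w = a * lc i b" using ia by (simp add: ab lc_mult lc_free)
    moreover have "lc i w = r\<^sup>2" by (simp add: lc_def deg_w lead)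
    ultimately have "\<rho> dvd r\<^sup>2" using \<rho>(2) by (metis dvd_mult2)
    then have "\<rho> dvd r" using prime_elem_dvd_power irreducible_mpoly_imp_prime_elem[OF \<rho>(1)] by blast
    then have "r dvd \<rho>" using irreducible_dvd_irreducible \<rho>(1) r(1) by blast
    then have "r dvd w" using \<rho>(2) ab by (meson dvd_mult2 dvd_trans)
    then have "r dvd \<pi>\<^sup>2 * h\<^sup>2" unfolding w_def by (simp add: power2_eq_square mult.assoc dvd_add_right_iff)
    then have "r dvd \<pi> \<or> r dvd h"
      using prime_elem_dvd_multD[OF primes(2)] prime_elem_dvd_power[OF primes(2)] by blast
    then show False
      using irreducible_dvd_irreducible[OF r(1) \<pi>(1)] irreducible_dvd_irreducible[OF r(1) h(1)] \<pi>(3)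
        mvars_dvd[of h r] nz h(2) r(2) by blast
  qed
  show ?thesis
    unfolding irreducible_def
  proof (intro conjI allI impI)
    show "w \<noteq> 0" using deg_w N by auto
    have "i \<in> mvars w" using deg_w N deg_eq_0_iff[of i w] by (auto simp: deg_def)
    then show "\<not> w dvd 1" by (auto simp: mpoly_is_unit_iff)
    show "a dvd 1 \<or> b dvd 1" if "w = a * b" for a b
      using eis[OF that] content[of a b] content[of b a] that by (auto simp: mult.commute)
  qed
qed

subsection \<open>Maximal minors modulo a prime element\<close>

lemma detm_eq_det: "detm m A = det (mat m m (\<lambda>(i, j). A i j))"
proof -
  have "(\<Prod>i = 0..<m. mat m m (\<lambda>(i, j). A i j) $$ (i, p i)) = (\<Prod>a<m. A a (p a))"
    if "p permutes {0..<m}" for p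
    unfolding lessThan_atLeast0
    by (rule prod.cong) (use permutes_in_image[OF that] in auto)
  then show ?thesis
    unfolding detm_def det_def'[OF mat_carrier] lessThan_atLeast0 by simp
qed

lemma detm_cong:
  assumes "\<And>a b. a < m \<Longrightarrow> b < m \<Longrightarrow> A a b = B a b"
  shows "detm m A = detm m B"
proof -
  have "mat m m (\<lambda>(i, j). A i j) = mat m m (\<lambda>(i, j). B i j)"
    using assms by (intro eq_matI) simp_all
  then show ?thesis by (simp only: detm_eq_det)
qed

lemma det_mat_swap:
  "det (mat m m (\<lambda>(i, j). A j i)) = det (mat m m (\<lambda>(i, j). A i j :: 'a::comm_ring_1))"
proof -
  have "mat m m (\<lambda>(i, j). A j i) = transpose_mat (mat m m (\<lambda>(i, j). A i j))"
    by (rule eq_matI) simp_all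
  then show ?thesis by (simp add: det_transpose[OF mat_carrier])
qed

lemma detm_permute_columns:
  assumes "\<sigma> permutes {..<m}"
  shows "detm m (\<lambda>a b. A a (\<sigma> b)) = of_int (sign \<sigma>) * detm m A"
proof -
  define M where "M = mat m m (\<lambda>(i, j). A j i)"
  have \<sigma>: "\<sigma> permutes {0..<m}" using assms by (simp add: lessThan_atLeast0)
  have "mat m m (\<lambda>(i, j). A j (\<sigma> i)) = mat m m (\<lambda>(i, j). M $$ (\<sigma> i, j))"
    using permutes_in_image[OF \<sigma>] by (intro eq_matI) (simp_all add: M_def)
  moreover have "M \<in> carrier_mat m m" by (simp add: M_def)
  ultimately have "det (mat m m (\<lambda>(i, j). A j (\<sigma> i))) = of_int (sign \<sigma>) * det M"
    using det_permute_rows[OF _ \<sigma>] by metis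
  then show ?thesis
    by (simp only: detm_eq_det det_mat_swap[of m "\<lambda>a b. A a (\<sigma> b)"] det_mat_swap[of m A] M_def)
qed

lemma detm_identical_columns:
  assumes "b < m" "c < m" "b \<noteq> c" "\<And>a. a < m \<Longrightarrow> A a b = A a c"
  shows "detm m A = 0"
  unfolding detm_eq_det
  by (rule det_identical_columns[of _ m b c]) (use assms in auto)

text \<open>\<open>jac_minors\<close> offers only increasing columns, while the construction of a
  row relation borders minors by arbitrary ones. Repeated columns give 0; distinct ones are sorted
  at the cost of a sign.\<close>

lemma dvd_minors_of_increasing:
  fixes A :: "nat \<Rightarrow> nat \<Rightarrow> 'a::comm_ring_1"
  assumes "\<And>idx. strict_mono_on {..<m} idx \<Longrightarrow> \<forall>b<m. idx b < n \<Longrightarrow> g dvd detm m (\<lambda>a b. A a (idx b))"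
    and "\<forall>b<m. idx b < n"
  shows "g dvd detm m (\<lambda>a b. A a (idx b))"
proof (cases "inj_on idx {..<m}")
  case False
  then obtain b c where "b < m" "c < m" "b \<noteq> c" "idx b = idx c"
    by (auto simp: inj_on_def)
  then show ?thesis by (subst detm_identical_columns[of b m c]) auto
next
  case True
  define S where "S = idx ` {..<m}"
  define xs where "xs = sorted_list_of_set S"
  have S: "finite S" "card S = m" using True by (auto simp: S_def card_image)
  have len: "length xs = m" and set: "set xs = S" and "sorted xs" "distinct xs"
    using S by (auto simp: xs_def)
  then have mono: "strict_mono_on {..<m} (\<lambda>b. xs ! b)"
    by (auto simp: strict_mono_on_def intro: sorted_wrt_nth_less[OF strict_sorted_list_of_set[of S, folded xs_def]])
  have bij1: "bij_betw (\<lambda>b. xs ! b) {..<m} S"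
    using bij_betw_nth[OF \<open>distinct xs\<close>] len set by simp
  have bij2: "bij_betw idx {..<m} S" using True by (auto simp: S_def bij_betw_def)
  \<comment> \<open>The position of column \<open>idx b\<close> in the sorted list; the identity
    beyond m, as \<open>permutes\<close> demands.\<close>
  define \<sigma> where "\<sigma> b = (if b < m then inv_into {..<m} ((!) xs) (idx b) else b)" for b
  have "bij_betw (inv_into {..<m} ((!) xs) \<circ> idx) {..<m} {..<m}"
    using bij2 bij_betw_inv_into[OF bij1] by (rule bij_betw_trans)
  then have "bij_betw \<sigma> {..<m} {..<m}"
    by (rule iffD1[OF bij_betw_cong, rotated]) (auto simp: \<sigma>_def)
  then have \<sigma>: "\<sigma> permutes {..<m}"
    by (rule bij_imp_permutes) (auto simp: \<sigma>_def)
  have idx: "idx b = xs ! \<sigma> b" if "b < m" for b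
    using that bij_betw_inv_into_right[OF bij1, of "idx b"] by (auto simp: \<sigma>_def S_def)
  have "detm m (\<lambda>a b. A a (idx b)) = detm m (\<lambda>a b. A a (xs ! \<sigma> b))"
    using idx by (intro detm_cong) simp
  also have "\<dots> = of_int (sign \<sigma>) * detm m (\<lambda>a b. A a (xs ! b))"
    by (rule detm_permute_columns[OF \<sigma>, of "\<lambda>a b. A a (xs ! b)"])
  finally have eq: "detm m (\<lambda>a b. A a (idx b)) = of_int (sign \<sigma>) * detm m (\<lambda>a b. A a (xs ! b))" .
  have "\<forall>b<m. xs ! b < n"
    using assms(2) set len by (metis (no_types, lifting) S_def imageE lessThan_iff nth_mem)
  then have "g dvd detm m (\<lambda>a b. A a (xs ! b))" using assms(1) mono by blast
  then show ?thesis unfolding eq by simp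
qed

lemma detm_Suc_last_column:
  "detm (Suc m) A = (\<Sum>a<Suc m. A a m * cofactor (mat (Suc m) (Suc m) (\<lambda>(i, j). A i j)) a m)"
  unfolding detm_eq_det
  by (subst laplace_expansion_column[OF mat_carrier, of m]) (simp_all del: sum.lessThan_Suc)

lemma cofactor_last:
  "cofactor (mat (Suc m) (Suc m) (\<lambda>(i, j). A i j)) m m = detm m A"
proof -
  have "mat_delete (mat (Suc m) (Suc m) (\<lambda>(i, j). A i j)) m m = mat m m (\<lambda>(i, j). A i j)"
    unfolding mat_delete_def by (rule eq_matI) simp_all
  then show ?thesis
    by (simp add: cofactor_def detm_eq_det flip: mult_2)
qed

text \<open>Expansion along the last column uses cofactors that never see that column, so the same
  coefficients serve for every column placed there.\<close>

lemma cofactor_last_cong: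
  assumes "\<And>a b. a < Suc m \<Longrightarrow> b < m \<Longrightarrow> A a b = B a b"
  shows "cofactor (mat (Suc m) (Suc m) (\<lambda>(i, j). A i j)) a m
       = cofactor (mat (Suc m) (Suc m) (\<lambda>(i, j). B i j)) a m"
proof -
  have "mat_delete (mat (Suc m) (Suc m) (\<lambda>(i, j). A i j)) a m
    = mat_delete (mat (Suc m) (Suc m) (\<lambda>(i, j). B i j)) a m"
    unfolding mat_delete_def using assms by (intro eq_matI) simp_all
  then show ?thesis by (simp only: cofactor_def)
qed

text \<open>If some minor on the rows below the last is not divisible by g, border it by the last
  row and a column \<open>l\<close>. Expanding along \<open>l\<close> gives a relation whose
  coefficients are cofactors independent of \<open>l\<close>, and the last of them is the chosen
  minor. Otherwise the induction hypothesis applies and the last coefficient is 0.\<close>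

lemma rows_dependent_mod_prime:
  fixes A :: "nat \<Rightarrow> nat \<Rightarrow> 'a::comm_ring_1"
  assumes g: "\<not> g dvd 1"
    and "\<And>idx. \<forall>b<m. idx b < n \<Longrightarrow> g dvd detm m (\<lambda>a b. A a (idx b))"
  shows "\<exists>u. (\<exists>a<m. \<not> g dvd u a) \<and> (\<forall>l<n. g dvd (\<Sum>a<m. u a * A a l))"
  using assms(2)
proof (induction m)
  case 0
  \<comment> \<open>The empty determinant is 1, so without rows the hypothesis would make g a
    unit.\<close>
  then show ?case using g by (simp add: detm_def)
next
  case (Suc m)
  show ?case
  proof (cases "\<forall>idx. (\<forall>b<m. idx b < n) \<longrightarrow> g dvd detm m (\<lambda>a b. A a (idx b))")
    case True
    then obtain u where u: "\<exists>a<m. \<not> g dvd u a" "\<forall>l<n. g dvd (\<Sum>a<m. u a * A a l)"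
      using Suc.IH by blast
    then show ?thesis
      by (intro exI[of _ "\<lambda>a. if a < m then u a else 0"]) (auto intro: less_SucI)
  next
    case False
    then obtain idx where idx: "\<forall>b<m. idx b < n" "\<not> g dvd detm m (\<lambda>a b. A a (idx b))"
      by blast
    define B where "B l a b = A a (if b < m then idx b else l)" for l a b
    define u where "u a = cofactor (mat (Suc m) (Suc m) (\<lambda>(i, j). B 0 i j)) a m" for a
    have "u m = detm m (B 0)" by (simp add: u_def cofactor_last)
    also have "\<dots> = detm m (\<lambda>a b. A a (idx b))"
      by (intro detm_cong) (simp add: B_def)
    finally have "\<not> g dvd u m" using idx(2) by simp
    moreover have "g dvd (\<Sum>a<Suc m. u a * A a l)" if "l < n" for l
    proof -
      have "detm (Suc m) (B l) = (\<Sum>a<Suc m. A a l * u a)"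
        using cofactor_last_cong[of m "B l" "B 0"]
        by (simp add: detm_Suc_last_column u_def B_def del: sum.lessThan_Suc)
      moreover have "g dvd detm (Suc m) (B l)"
        unfolding B_def using idx(1) that by (intro Suc.prems) auto
      ultimately show ?thesis by (simp add: mult.commute)
    qed
    ultimately show ?thesis by blast
  qed
qed

text \<open>Cramer's rule without division: multiplying u A by the adjugate turns u A = 0 modulo g
  into u_a det A = 0 modulo g.\<close>

lemma dvd_detm_if_row_relation:
  fixes A :: "nat \<Rightarrow> nat \<Rightarrow> 'a::comm_ring_1"
  assumes "prime_elem g" "\<And>b. b < m \<Longrightarrow> g dvd (\<Sum>a<m. u a * A a b)" "a < m" "\<not> g dvd u a"
  shows "g dvd detm m A"
proof -
  define M where "M = mat m m (\<lambda>(i, j). A i j)"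
  have M: "M \<in> carrier_mat m m" by (simp add: M_def)
  note adj = adj_mat(1,2)[OF M]
  have entry: "(\<Sum>j<m. A i j * adj_mat M $$ (j, a)) = (if i = a then det M else 0)" if "i < m" for i
  proof -
    have "(M * adj_mat M) $$ (i, a) = (\<Sum>j<m. A i j * adj_mat M $$ (j, a))"
      using that assms(3) adj(1) M
      by (auto simp: scalar_prod_def M_def lessThan_atLeast0 intro!: sum.cong)
    then show ?thesis using that assms(3) by (auto simp: adj(2))
  qed
  have "(\<Sum>b<m. (\<Sum>i<m. u i * A i b) * adj_mat M $$ (b, a))
      = (\<Sum>i<m. u i * (\<Sum>b<m. A i b * adj_mat M $$ (b, a)))"
    unfolding sum_distrib_left sum_distrib_right mult.assoc by (rule sum.swap)
  also have "\<dots> = (\<Sum>i<m. if i = a then u i * det M else 0)"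
    by (intro sum.cong refl) (simp add: entry)
  also have "\<dots> = u a * detm m A"
    using assms(3) by (simp add: detm_eq_det M_def)
  finally have "u a * detm m A = (\<Sum>b<m. (\<Sum>i<m. u i * A i b) * adj_mat M $$ (b, a))" by simp
  also have "g dvd \<dots>" by (intro dvd_sum dvd_mult2 assms(2)) auto
  finally show ?thesis using prime_elem_dvd_multD[OF assms(1)] assms(4) by blast
qed

subsection \<open>Derivations of the residue domain\<close>

text \<open>Take a nonzero element of least \<open>sdeg\<close>. In a factorisation one factor lies
  in \<open>Z\<close> and must have full size, so the other is a unit. A derivative by an occurring
  variable is nonzero in characteristic zero and smaller, hence outside \<open>Z\<close>. The bound
  \<open>V\<close> lets the choice be made among polynomials free of a given variable.\<close>

lemma obtain_irreducible_pdiff_outside: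
  fixes Z :: "'a::field_char_0 mpoly \<Rightarrow> bool"
  assumes "Z p" "p \<noteq> 0" "mvars p \<subseteq> V"
    and prime: "\<And>a b. Z (a * b) \<Longrightarrow> Z a \<or> Z b" and proper: "\<And>c. c dvd 1 \<Longrightarrow> \<not> Z c"
  obtains h i where "Z h" "irreducible h" "mvars h \<subseteq> V" "i \<in> mvars h" "\<not> Z (pdiff i h)"
proof -
  define Q where "Q y \<longleftrightarrow> Z y \<and> y \<noteq> 0 \<and> mvars y \<subseteq> V" for y
  have "\<exists>h. Q h \<and> (\<forall>y. Q y \<longrightarrow> sdeg h \<le> sdeg y)"
    by (rule ex_has_least_nat[of Q p]) (use assms in \<open>simp add: Q_def\<close>)
  then obtain h where h: "Q h" "\<And>y. Q y \<Longrightarrow> sdeg h \<le> sdeg y" by blast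
  have "\<not> h dvd 1" using h(1) proper unfolding Q_def by blast
  have "irreducible h"
    unfolding irreducible_def
  proof (intro conjI allI impI)
    fix a b assume ab: "h = a * b"
    have nz: "a \<noteq> 0" "b \<noteq> 0" using h(1) ab by (auto simp: Q_def)
    have "mvars a \<subseteq> V" "mvars b \<subseteq> V"
      using h(1) mvars_dvd[of a h] mvars_dvd[of b h] unfolding Q_def ab by auto
    then have "Q a \<or> Q b" using prime[of a b] h(1) nz unfolding Q_def ab by blast
    then have "sdeg a = 0 \<or> sdeg b = 0" using h(2)[of a] h(2)[of b] nz by (auto simp: ab sdeg_mult)
    then show "a dvd 1 \<or> b dvd 1" using nz by (simp add: sdeg_eq_0_iff mpoly_is_unit_iff)
  qed (use h(1) \<open>\<not> h dvd 1\<close> in \<open>auto simp: Q_def\<close>)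
  then obtain i where i: "i \<in> mvars h" using irreducible_mvars by blast
  have "\<not> Q (pdiff i h)" using h(2)[of "pdiff i h"] sdeg_pdiff_less[OF i] by linarith
  then have "\<not> Z (pdiff i h)"
    using h(1) mvars_pdiff[of h V i] deg_pdiff_less(1)[OF i] unfolding Q_def by blast
  with \<open>irreducible h\<close> i h(1) show ?thesis using that unfolding Q_def by blast
qed

lemma subst_sum: "subst F (\<Sum>x\<in>S. a x) = (\<Sum>x\<in>S. subst F (a x :: 'a::comm_ring_1 mpoly))"
  by (induction S rule: infinite_finite_induct) (auto simp: subst_add)

lemma subst_of_nat: "subst F (of_nat k :: 'a::comm_ring_1 mpoly) = of_nat k"
  using subst_pC[of F "of_nat k :: 'a"] by simp

lemma of_nat_dvd_1_mpoly:
  assumes "k > 0"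
  shows "(of_nat k :: 'a::field_char_0 mpoly) dvd 1"
  using assms mvars_pC[of "of_nat k :: 'a"] by (simp add: mpoly_is_unit_iff)

text \<open>The value at \<open>p\<close> of the derivation over evaluation at \<open>F\<close> that
  kills constants and sends the variable z_i to \<open>v i\<close>.\<close>

definition deriv_along ::
  "nat \<Rightarrow> (nat \<Rightarrow> 'a::comm_ring_1 mpoly) \<Rightarrow> (nat \<Rightarrow> 'a mpoly) \<Rightarrow> 'a mpoly \<Rightarrow> 'a mpoly" where
  "deriv_along N v F p = (\<Sum>i<N. v i * subst F (pdiff i p))"

lemma deriv_along_add: "deriv_along N v F (p + q) = deriv_along N v F p + deriv_along N v F q"
  by (simp add: deriv_along_def pdiff_add subst_add distrib_left sum.distrib)

lemma deriv_along_0 [simp]: "deriv_along N v F 0 = 0"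
  by (simp add: deriv_along_def)

lemma deriv_along_sum:
  "deriv_along N v F (\<Sum>x\<in>S. a x) = (\<Sum>x\<in>S. deriv_along N v F (a x))"
  by (induction S rule: infinite_finite_induct) (auto simp: deriv_along_add)

lemma deriv_along_diff: "deriv_along N v F (p - q) = deriv_along N v F p - deriv_along N v F q"
  using deriv_along_add[of N v F "p - q" q] by simp

lemma deriv_along_mult:
  "deriv_along N v F (p * q) = subst F p * deriv_along N v F q + subst F q * deriv_along N v F p"
  by (simp add: deriv_along_def pdiff_mult subst_add subst_mult sum.distrib sum_distrib_left algebra_simps)

lemma deriv_along_pX: "k < N \<Longrightarrow> deriv_along N v F (pX k) = v k"
proof -
  assume "k < N"
  have "deriv_along N v F (pX k) = (\<Sum>i<N. if i = k then v i else 0)"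
    unfolding deriv_along_def by (rule sum.cong) (auto simp: pdiff_pX)
  then show ?thesis using \<open>k < N\<close> by simp
qed

lemma deriv_along_subst:
  assumes "mvars p \<subseteq> {..<n}"
  shows "deriv_along N v F (subst G p)
    = (\<Sum>j<n. subst F (subst G (pdiff j p)) * deriv_along N v F (G j))"
proof -
  have "deriv_along N v F (subst G p)
    = (\<Sum>i<N. \<Sum>j<n. v i * (subst F (subst G (pdiff j p)) * subst F (pdiff i (G j))))"
    by (simp add: deriv_along_def pdiff_subst[OF assms] subst_sum subst_mult sum_distrib_left)
  also have "\<dots> = (\<Sum>j<n. \<Sum>i<N. v i * (subst F (subst G (pdiff j p)) * subst F (pdiff i (G j))))"
    by (rule sum.swap)
  finally show ?thesis by (simp add: deriv_along_def sum_distrib_left mult_ac)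
qed

text \<open>The assignment \<open>p(F) \<mapsto> deriv_along N v F p\<close> is well defined modulo \<open>g\<close>, that is, a derivation
  of the image of \<open>k[z\<^sub>0,\<dots>,z\<^sub>N\<^sub>-\<^sub>1]\<close> in \<open>k[x]/(g)\<close>.\<close>

definition derivation_mod ::
  "'a::comm_ring_1 mpoly \<Rightarrow> (nat \<Rightarrow> 'a mpoly) \<Rightarrow> nat \<Rightarrow> (nat \<Rightarrow> 'a mpoly) \<Rightarrow> bool" where
  "derivation_mod g F N v \<longleftrightarrow>
     (\<forall>p. mvars p \<subseteq> {..<N} \<longrightarrow> g dvd subst F p \<longrightarrow> g dvd deriv_along N v F p)"

text \<open>The value at z_N is immaterial here: by the product rule it enters only multiplied by a
  coefficient of \<open>p\<close>, and these vanish at \<open>F\<close> modulo g.\<close>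

lemma derivation_mod_coeffs:
  fixes g :: "'a::idom mpoly"
  assumes "derivation_mod g F N v" and v': "\<And>i. i < N \<Longrightarrow> v' i = s * v i"
    and p: "mvars p \<subseteq> {..<Suc N}" and coeffs: "\<And>d. g dvd subst F (coeff (upoly N p) d)"
  shows "g dvd deriv_along (Suc N) v' F p"
proof -
  have "g dvd deriv_along (Suc N) v' F (coeff (upoly N p) d)" for d
  proof -
    let ?c = "coeff (upoly N p) d"
    have "mvars ?c \<subseteq> {..<N}" using mvars_coeff_upoly[OF p, of N d] by auto
    then have "g dvd deriv_along N v F ?c"
      using assms(1) coeffs unfolding derivation_mod_def by blast
    moreover have "deriv_along (Suc N) v' F ?c = s * deriv_along N v F ?c"
      by (simp add: deriv_along_def v' sum_distrib_left mult.assoc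
          pdiff_notin_mvars[OF mvars_coeff_upoly'])
    ultimately show ?thesis by simp
  qed
  then have "g dvd deriv_along (Suc N) v' F (\<Sum>d\<le>degree (upoly N p). coeff (upoly N p) d * pX N ^ d)"
    unfolding deriv_along_sum deriv_along_mult using coeffs by (intro dvd_sum dvd_add) auto
  then show ?thesis using upoly_sum_expand[of p N] by simp
qed

text \<open>Derivations of the residue domain extend along algebraic and along transcendental generators;
  the factor \<open>s\<close> clears the denominator in the algebraic case.\<close>

lemma derivation_mod_extend_step:
  fixes g :: "'a::field_char_0 mpoly"
  assumes g: "prime_elem g" and v: "derivation_mod g F N v"
  shows "\<exists>s v'. \<not> g dvd s \<and> (\<forall>i<N. v' i = s * v i) \<and> derivation_mod g F (Suc N) v'"
\<comment> \<open>Transcendental case: the residue of \<open>F N\<close> satisfies no nontrivial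
  relation over the earlier ones, so any value at z_N is allowed.\<close>
proof (cases "\<forall>p d. mvars p \<subseteq> {..<Suc N} \<longrightarrow> g dvd subst F p \<longrightarrow> g dvd subst F (coeff (upoly N p) d)")
  case True
  have "derivation_mod g F (Suc N) v"
    unfolding derivation_mod_def using True derivation_mod_coeffs[OF v, of v 1] by auto
  then show ?thesis using g by (intro exI[of _ 1] exI[of _ v]) (auto simp: prime_elem_def)
next
  case False
  \<comment> \<open>Relations that stay nontrivial when their coefficients are reduced modulo g. One
    of least z_N-degree, \<open>H\<close>, takes the place of a minimal polynomial.\<close>
  define Q where "Q p \<longleftrightarrow> mvars p \<subseteq> {..<Suc N} \<and> g dvd subst F p \<and>
    (\<exists>d. \<not> g dvd subst F (coeff (upoly N p) d))" for p
  obtain H0 where "Q H0" using False unfolding Q_def by blast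
  then have "\<exists>H. Q H \<and> (\<forall>y. Q y \<longrightarrow> deg N H \<le> deg N y)" by (rule ex_has_least_nat)
  then obtain H where H: "Q H" "\<And>y. Q y \<Longrightarrow> deg N H \<le> deg N y" by blast
  have HV: "mvars H \<subseteq> {..<Suc N}" and HZ: "g dvd subst F H" using H(1) by (auto simp: Q_def)
  have "H \<noteq> 0" using H(1) by (auto simp: Q_def)
  have degH: "deg N H > 0"
  proof (rule ccontr)
    assume "\<not> deg N H > 0"
    then have "upoly N H = [:H:]" using deg_eq_0_iff[of N H] upoly_free by auto
    then have "\<forall>d. g dvd subst F (coeff (upoly N H) d)"
      using HZ by (auto simp: coeff_pCons split: nat.splits)
    then show False using H(1) by (auto simp: Q_def)
  qed
  have lead: "\<not> g dvd subst F (lc N H)"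
  proof
    assume *: "g dvd subst F (lc N H)"
    define H' where "H' = H - lc N H * pX N ^ deg N H"
    have "deg N H' < deg N H" and eq: "upoly N H' = upoly N H - monom (lc N H) (deg N H)"
      unfolding H'_def using deg_minus_lead[OF degH] by auto
    moreover have "Q H'"
    proof -
      obtain d where d: "\<not> g dvd subst F (coeff (upoly N H) d)" using H(1) by (auto simp: Q_def)
      then have "d \<noteq> deg N H" using * by (auto simp: lc_def deg_def)
      then have "coeff (upoly N H') d = coeff (upoly N H) d" by (simp add: eq)
      moreover have "mvars H' \<subseteq> {..<Suc N}"
        unfolding H'_def using HV by (intro mvars_minus_lead) auto
      moreover have "g dvd subst F H'"
        unfolding H'_def subst_diff subst_mult using * HZ by (intro dvd_diff dvd_mult2) auto
      ultimately show ?thesis using d unfolding Q_def by metis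
    qed
    ultimately show False using H(2) by fastforce
  qed
  \<comment> \<open>Separability: in characteristic zero the derivative of \<open>H\<close> has a
    leading coefficient nonzero modulo g, so if g divided s it would be a nontrivial relation of
    smaller degree.\<close>
  define s where "s = subst F (pdiff N H)"
  have s: "\<not> g dvd s"
  proof
    assume *: "g dvd s"
    have "coeff (upoly N (pdiff N H)) (deg N H - 1) = of_nat (deg N H) * lc N H"
      using degH by (simp add: upoly_pdiff coeff_pderiv lc_def deg_def)
    moreover have "\<not> g dvd subst F (of_nat (deg N H) * lc N H)"
    proof
      assume "g dvd subst F (of_nat (deg N H) * lc N H)"
      then have "g dvd of_nat (deg N H) * subst F (lc N H)"
        by (simp add: subst_mult subst_of_nat)
      then show False
        using g lead of_nat_dvd_1_mpoly[OF degH] prime_elem_dvd_multD[OF g] dvd_trans[of g _ 1]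
        by (auto simp: prime_elem_def)
    qed
    ultimately have "Q (pdiff N H)"
      using * mvars_pdiff[OF HV, of N] unfolding Q_def s_def by metis
    then show False using H(2) deg_pdiff_less(2)[of N H] degH deg_eq_0_iff[of N H] by fastforce
  qed
  \<comment> \<open>The value at z_N is chosen to make D(H) = 0; scaling the old values by s avoids
    dividing by s.\<close>
  define v' where "v' i = (if i < N then s * v i else - deriv_along N v F H)" for i
  have DH: "deriv_along (Suc N) v' F H = 0"
    by (simp add: deriv_along_def v'_def s_def sum_distrib_left sum_negf mult_ac)
  have "derivation_mod g F (Suc N) v'"
    unfolding derivation_mod_def
  proof (intro allI impI)
    fix p assume p: "mvars p \<subseteq> {..<Suc N}" "g dvd subst F p"
    \<comment> \<open>By minimality of \<open>H\<close> the remainder has all its coefficients zero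
      modulo g, which is the case of \<open>derivation_mod_coeffs\<close>; the multiplier is then
      removed by primeness.\<close>
    obtain k q r where qr: "lc N H ^ k * p = q * H + r" "mvars r \<subseteq> {..<Suc N}"
      "r = 0 \<or> deg N r < deg N H"
      using mpoly_pseudo_div[OF \<open>H \<noteq> 0\<close> p(1) HV] by blast
    let ?D = "deriv_along (Suc N) v' F" and ?c = "lc N H ^ k"
    have r: "r = ?c * p - q * H" using qr(1) by simp
    have "g dvd subst F r" unfolding r subst_diff subst_mult using p(2) HZ by (intro dvd_diff) auto
    moreover have "\<not> Q r"
    proof
      assume "Q r"
      then show False using qr(3) H(2)[OF \<open>Q r\<close>] unfolding Q_def by auto
    qed
    ultimately have "g dvd subst F (coeff (upoly N r) d)" for d
      using qr(2) unfolding Q_def by blast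
    then have "g dvd ?D r"
      using derivation_mod_coeffs[OF v _ qr(2), of v' s] by (simp add: v'_def)
    moreover have "g dvd ?D (q * H)" unfolding deriv_along_mult DH using HZ by simp
    ultimately have "g dvd ?D (?c * p)" unfolding qr(1) deriv_along_add by simp
    then have "g dvd subst F ?c * ?D p"
      unfolding deriv_along_mult using p(2) by (simp add: dvd_add_left_iff)
    moreover have "\<not> g dvd subst F ?c"
      unfolding subst_power using lead prime_elem_dvd_power[OF g] by blast
    ultimately show "g dvd ?D p" using prime_elem_dvd_multD[OF g] by blast
  qed
  then show ?thesis using s by (intro exI[of _ s] exI[of _ v']) (auto simp: v'_def)
qed

lemma derivation_mod_extend:
  fixes g :: "'a::field_char_0 mpoly"
  assumes g: "prime_elem g" and v: "derivation_mod g F M v"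
  shows "\<exists>s v'. \<not> g dvd s \<and> (\<forall>i<M. v' i = s * v i) \<and> derivation_mod g F (M + k) v'"
proof (induction k)
  case 0
  then show ?case using g v by (intro exI[of _ 1] exI[of _ v]) (auto simp: prime_elem_def)
next
  case (Suc k)
  then obtain s v' where *: "\<not> g dvd s" "\<forall>i<M. v' i = s * v i" "derivation_mod g F (M + k) v'" by blast
  obtain s' v'' where **: "\<not> g dvd s'" "\<forall>i<M + k. v'' i = s' * v' i" "derivation_mod g F (Suc (M + k)) v''"
    using derivation_mod_extend_step[OF g *(3)] by blast
  have "\<not> g dvd s' * s" using *(1) **(1) prime_elem_dvd_multD[OF g] by blast
  then show ?case using * ** by (intro exI[of _ "s' * s"] exI[of _ v'']) (auto simp: mult.assoc)
qed

text \<open>Adjoining the coordinates \<open>x\<^sub>1,\<dots>,x\<^sub>n\<close> to \<open>f\<^sub>1,\<dots>,f\<^sub>m\<close> one at a time, a derivation on the residues of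
  the \<open>f\<^sub>a\<close> extends to \<open>k[x]/(g)\<close>; there it is a combination of the partial derivatives, so a row
  relation of the Jacobian matrix annihilates its values on the \<open>f\<^sub>a\<close>.\<close>

lemma jacobian_relation_annihilates:
  fixes g :: "'a::field_char_0 mpoly"
  assumes g: "prime_elem g" and f: "\<And>a. a < m \<Longrightarrow> mvars (f a) \<subseteq> {..<n}"
    and u: "\<And>l. l < n \<Longrightarrow> g dvd (\<Sum>a<m. u a * pdiff l (f a))" and v: "derivation_mod g f m v"
  shows "g dvd (\<Sum>a<m. u a * v a)"
proof -
  \<comment> \<open>Positions below m hold the f_a, position m + j holds the coordinate x_j.\<close>
  define F where "F i = (if i < m then f i else pX (i - m))" for i
  have Ff: "subst F p = subst f p" if "mvars p \<subseteq> {..<m}" for p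
    by (rule subst_cong) (use that in \<open>auto simp: F_def\<close>)
  have "deriv_along m v F p = deriv_along m v f p" if "mvars p \<subseteq> {..<m}" for p
    unfolding deriv_along_def using Ff[OF mvars_pdiff[OF that]] by simp
  then have "derivation_mod g F m v" using v Ff unfolding derivation_mod_def by metis
  then obtain s v' where s: "\<not> g dvd s" "\<forall>i<m. v' i = s * v i" "derivation_mod g F (m + n) v'"
    using derivation_mod_extend[OF g] by blast
  define J where "J a = (\<Sum>j<n. pdiff j (f a) * v' (m + j))" for a
  \<comment> \<open>The relation f_a(z_m,...,z_(m+n-1)) - z_a = 0 holds at \<open>F\<close>. The
    extended derivation applied to it gives s v_a = \<open>J a\<close> modulo g.\<close>
  have row: "g dvd J a - s * v a" if a: "a < m" for a
  proof -
    define G where "G j = (pX (m + j) :: 'a mpoly)" for j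
    have FG: "subst F (subst G p) = p" for p
      by (rule subst_subst_pX) (simp add: F_def G_def)
    have "mvars (subst G (f a) - pX a) \<subseteq> {..<m + n}"
      using f[OF a] a by (intro mvars_diffI mvars_substI) (auto simp: G_def)
    moreover have "subst F (subst G (f a) - pX a) = 0"
      using a by (simp add: subst_diff FG F_def)
    ultimately have "g dvd deriv_along (m + n) v' F (subst G (f a) - pX a)"
      using s(3) unfolding derivation_mod_def by auto
    moreover have "deriv_along (m + n) v' F (subst G (f a)) = J a"
      unfolding deriv_along_subst[OF f[OF a]] FG J_def
      by (intro sum.cong) (auto simp: G_def deriv_along_pX)
    ultimately show ?thesis using a s(2) by (simp add: deriv_along_diff deriv_along_pX)
  qed
  have "(\<Sum>a<m. u a * J a) = (\<Sum>a<m. \<Sum>j<n. v' (m + j) * (u a * pdiff j (f a)))"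
    by (simp add: J_def sum_distrib_left mult_ac)
  also have "\<dots> = (\<Sum>j<n. v' (m + j) * (\<Sum>a<m. u a * pdiff j (f a)))"
    unfolding sum_distrib_left by (rule sum.swap)
  also have "g dvd \<dots>" by (intro dvd_sum dvd_mult[OF u]) auto
  finally have J: "g dvd (\<Sum>a<m. u a * J a)" .
  have "g dvd (\<Sum>a<m. u a * J a) - (\<Sum>a<m. u a * (J a - s * v a))"
    by (rule dvd_diff[OF J dvd_sum[OF dvd_mult[OF row]]]) simp
  also have "(\<Sum>a<m. u a * J a) - (\<Sum>a<m. u a * (J a - s * v a)) = s * (\<Sum>a<m. u a * v a)"
    by (simp add: sum_subtractf[symmetric] sum_distrib_left algebra_simps)
  finally show ?thesis using prime_elem_dvd_multD[OF g] s(1) by blast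
qed

subsection \<open>Squares dividing substituted polynomials\<close>

lemma not_dvd_pdiff_self:
  fixes g :: "'a::field_char_0 mpoly"
  assumes "l \<in> mvars g"
  shows "\<not> g dvd pdiff l g"
proof
  assume "g dvd pdiff l g"
  then obtain z where z: "pdiff l g = g * z" by blast
  with deg_pdiff_less[OF assms] show False by (auto simp: z deg_mult)
qed

lemma gradient_in_kernel_if_square_dvd:
  fixes g :: "'a::comm_ring_1 mpoly"
  assumes "g\<^sup>2 dvd subst f p" "mvars p \<subseteq> {..<m}"
  shows "g dvd (\<Sum>a<m. subst f (pdiff a p) * pdiff l (f a))"
proof -
  obtain q where "subst f p = g * (g * q)" using assms(1) by (auto simp: power2_eq_square mult.assoc)
  then have "pdiff l (subst f p) = g * pdiff l (g * q) + g * q * pdiff l g"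
    by (simp add: pdiff_mult)
  moreover have "g dvd g * pdiff l (g * q) + g * q * pdiff l g"
    by (intro dvd_add) (simp_all add: mult.assoc)
  ultimately show ?thesis by (simp add: pdiff_subst[OF assms(2)])
qed

text \<open>A minor not divisible by g makes every u with u J = 0 modulo g vanish modulo g. This is
  used for the gradient of \<open>w\<close>, for a combination of the gradients of \<open>h\<close>
  and \<open>r\<close>, and finally for the gradient of \<open>r\<close> alone.\<close>

lemma dvd_minor_if_square_dvd_squarefree:
  fixes g :: "'a::field_char_0 mpoly"
  assumes g: "prime_elem g" and w: "squarefree w" "mvars w \<subseteq> {..<m}" "g\<^sup>2 dvd subst f w"
  shows "g dvd detm m (\<lambda>a b. pdiff (idx b) (f a))"
proof (rule ccontr)
  assume nd: "\<not> g dvd detm m (\<lambda>a b. pdiff (idx b) (f a))"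
  have ker: "g dvd u a" if "\<And>l. g dvd (\<Sum>a<m. u a * pdiff l (f a))" "a < m" for u a
    using dvd_detm_if_row_relation[OF g, of m u "\<lambda>a b. pdiff (idx b) (f a)"] that nd by blast
  define Z where "Z p \<longleftrightarrow> g dvd subst f p" for p
  have Z_prime: "Z a \<or> Z b" if "Z (a * b)" for a b
    using that prime_elem_dvd_multD[OF g] unfolding Z_def subst_mult by blast
  have Z_proper: "\<not> Z c" if "c dvd 1" for c
    using subst_dvd_1[OF that, of f] g dvd_trans unfolding Z_def prime_elem_def by blast
  \<comment> \<open>Every square divides 0, so a square-free 0 would make the variable x_0 a
    unit.\<close>
  have "w \<noteq> 0"
  proof
    assume "w = 0"
    then have "(pX 0 + pC 0 :: 'a mpoly) dvd 1" using w(1) unfolding squarefree_def by simp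
    then show False using irreducible_pX_add[of 0 "0::'a"] by (simp add: irreducible_def)
  qed
  have Zw: "Z w" using w(3) unfolding Z_def by (auto simp: power2_eq_square dest: dvd_mult_left)
  have Zdw: "Z (pdiff a w)" if "a < m" for a
    using ker[of "\<lambda>a. subst f (pdiff a w)" a] gradient_in_kernel_if_square_dvd[OF w(3,2)] that
    unfolding Z_def by blast
  obtain h i where h: "Z h" "irreducible h" "mvars h \<subseteq> {..<m}" "i \<in> mvars h" "\<not> Z (pdiff i h)"
    by (rule obtain_irreducible_pdiff_outside[of Z w "{..<m}"])
       (use Zw \<open>w \<noteq> 0\<close> w(2) Z_prime Z_proper in blast)+
  have i: "i < m" using h by auto
  obtain s t where st: "s * w + t * pdiff i w \<noteq> 0" "mvars (s * w + t * pdiff i w) \<subseteq> {..<m} - {i}"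
    using eliminate_variable[OF \<open>w \<noteq> 0\<close> w(2) mvars_pdiff[OF w(2)], of i i]
      squarefree_pdiff_coprime[OF w(1)] by blast
  have "Z (s * w + t * pdiff i w)"
    using Zw Zdw[OF i] unfolding Z_def subst_add subst_mult by (intro dvd_add) auto
  then obtain r j where r: "Z r" "mvars r \<subseteq> {..<m} - {i}" "j \<in> mvars r" "\<not> Z (pdiff j r)"
    by (rule obtain_irreducible_pdiff_outside[of Z _ "{..<m} - {i}"])
       (use st Z_prime Z_proper in blast)+
  have rm: "mvars r \<subseteq> {..<m}" and j: "j < m" using r by auto
  have ri: "pdiff i r = 0" using r(2) by (intro pdiff_notin_mvars) auto
  obtain a b where a: "subst f h = g * a" and b: "subst f r = g * b"
    using h(1) r(1) unfolding Z_def by blast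
  \<comment> \<open>These weights cancel the terms along grad g: b d(g a) - a d(g b) = g (b da - a
    db).\<close>
  define u where "u c = b * subst f (pdiff c h) - a * subst f (pdiff c r)" for c
  have "g dvd (\<Sum>c<m. u c * pdiff l (f c))" for l
  proof -
    have "(\<Sum>c<m. u c * pdiff l (f c)) = b * pdiff l (subst f h) - a * pdiff l (subst f r)"
      unfolding pdiff_subst[OF h(3)] pdiff_subst[OF rm]
      by (simp add: u_def sum_distrib_left sum_subtractf algebra_simps)
    also have "\<dots> = g * (b * pdiff l a - a * pdiff l b)"
      by (simp add: a b pdiff_mult algebra_simps)
    finally show ?thesis by simp
  qed
  \<comment> \<open>Since \<open>r\<close> is free of variable i, only the gradient of
    \<open>h\<close> contributes to this coordinate. Hence g | b, so g^2 | r(f), and every partial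
    derivative of \<open>r\<close> would lie in P.\<close>
  then have "g dvd u i" using ker i by blast
  then have "g dvd b * subst f (pdiff i h)" by (simp add: u_def ri)
  then have "g dvd b" using h(5) prime_elem_dvd_multD[OF g] unfolding Z_def by blast
  then have "g\<^sup>2 dvd subst f r" by (auto simp: b power2_eq_square mult_dvd_mono)
  then have "Z (pdiff j r)"
    using ker[of "\<lambda>a. subst f (pdiff a r)" j] gradient_in_kernel_if_square_dvd[OF _ rm] j
    unfolding Z_def by blast
  then show False using r(4) by blast
qed

lemma irreducible_square_dvd_if_dvd_minors:
  fixes g :: "'a::field_char_0 mpoly"
  assumes g: "irreducible g" "mvars g \<subseteq> {..<n}" and f: "\<And>a. a < m \<Longrightarrow> mvars (f a) \<subseteq> {..<n}"
    and minors: "\<And>idx. strict_mono_on {..<m} idx \<Longrightarrow> \<forall>b<m. idx b < n \<Longrightarrow>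
      g dvd detm m (\<lambda>a b. pdiff (idx b) (f a))"
  shows "\<exists>w. mvars w \<subseteq> {..<m} \<and> irreducible w \<and> g\<^sup>2 dvd subst f w"
proof -
  have prime: "prime_elem g" using irreducible_mpoly_imp_prime_elem g(1) by blast
  have "\<not> g dvd 1" using g(1) by (auto simp: irreducible_def)
  then obtain u where u: "\<exists>a<m. \<not> g dvd u a" "\<forall>l<n. g dvd (\<Sum>a<m. u a * pdiff l (f a))"
    using rows_dependent_mod_prime[of g m n "\<lambda>a l. pdiff l (f a)"]
      dvd_minors_of_increasing[of m n g "\<lambda>a l. pdiff l (f a)", OF minors] by blast
  then obtain b0 where b0: "b0 < m" "\<not> g dvd u b0" by blast
  have annihilates: "g dvd (\<Sum>a<m. u a * v a)" if "derivation_mod g f m v" for v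
    by (rule jacobian_relation_annihilates[OF prime _ _ that]) (use f u(2) in auto)
  define Z where "Z p \<longleftrightarrow> g dvd subst f p" for p
  have Z_prime: "Z a \<or> Z b" if "Z (a * b)" for a b
    using that prime_elem_dvd_multD[OF prime] unfolding Z_def subst_mult by blast
  have Z_proper: "\<not> Z c" if "c dvd 1" for c
    using subst_dvd_1[OF that, of f] \<open>\<not> g dvd 1\<close> dvd_trans unfolding Z_def by blast
  have "\<exists>p. Z p \<and> p \<noteq> 0 \<and> mvars p \<subseteq> {..<m}"
  proof (rule ccontr)
    assume "\<nexists>p. Z p \<and> p \<noteq> 0 \<and> mvars p \<subseteq> {..<m}"
    then have zero: "p = 0" if "mvars p \<subseteq> {..<m}" "g dvd subst f p" for p
      using that unfolding Z_def by blast
    \<comment> \<open>If P were zero, every vector would define a derivation; the unit vector at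
      \<open>b0\<close> then gives g | u_b0.\<close>
    have "derivation_mod g f m (\<lambda>i. if i = b0 then 1 else 0)"
      unfolding derivation_mod_def by (auto dest: zero)
    then have "g dvd (\<Sum>a<m. u a * (if a = b0 then 1 else 0))" by (rule annihilates)
    also have "(\<Sum>a<m. u a * (if a = b0 then 1 else 0)) = u b0"
      using b0 by (simp add: if_distrib cong: if_cong)
    finally show False using b0 by blast
  qed
  then obtain h i where h: "Z h" "irreducible h" "mvars h \<subseteq> {..<m}" "i \<in> mvars h" "\<not> Z (pdiff i h)"
    using obtain_irreducible_pdiff_outside[of Z _ "{..<m}"] Z_prime Z_proper by metis
  have "h \<noteq> 0" using h(2) by auto
  show ?thesis
  proof (cases "\<exists>p. mvars p \<subseteq> {..<m} \<and> Z p \<and> \<not> h dvd p")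
    case True
    then obtain p where p: "mvars p \<subseteq> {..<m}" "Z p" "\<not> h dvd p" by blast
    \<comment> \<open>An element of P outside (h) shares no irreducible factor with
      \<open>h\<close>, so variable i can be eliminated from the two.\<close>
    have False if "irreducible \<pi>" "\<pi> dvd h" "\<pi> dvd p" for \<pi>
      using irreducible_dvd_irreducible[OF that(1) h(2) that(2)] that(3) p(3) dvd_trans by blast
    then obtain s t where st: "s * h + t * p \<noteq> 0" "mvars (s * h + t * p) \<subseteq> {..<m} - {i}"
      using eliminate_variable[OF \<open>h \<noteq> 0\<close> h(3) p(1), of i] by blast
    have "Z (s * h + t * p)"
      using h(1) p(2) unfolding Z_def subst_add subst_mult by (intro dvd_add) auto
    then obtain r j where r: "Z r" "irreducible r" "mvars r \<subseteq> {..<m} - {i}" "j \<in> mvars r"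
      by (rule obtain_irreducible_pdiff_outside[of Z _ "{..<m} - {i}"])
         (use st Z_prime Z_proper in blast)+
    have j: "j < m" "j \<noteq> i" and ri: "i \<notin> mvars r" and rm: "mvars r \<subseteq> {..<m}" using r by auto
    \<comment> \<open>Otherwise x_j and x_j + 1 would both be associated to \<open>r\<close>, and
      x_j would divide their difference 1.\<close>
    have "\<exists>c. \<not> (pX j + pC c :: 'a mpoly) dvd r"
    proof (rule ccontr)
      assume "\<nexists>c. \<not> (pX j + pC c :: 'a mpoly) dvd r"
      then have "(pX j + pC 0 :: 'a mpoly) dvd r" "(pX j + pC 1 :: 'a mpoly) dvd r" by blast+
      then have "(pX j + pC 0 :: 'a mpoly) dvd pX j + pC 1"
        using irreducible_dvd_irreducible[OF irreducible_pX_add r(2)] dvd_trans by blast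
      then have "(pX j + pC 0 :: 'a mpoly) dvd 1" by (simp add: dvd_add_right_iff)
      then show False using irreducible_pX_add[of j "0::'a"] by (simp add: irreducible_def)
    qed
    then obtain c where c: "\<not> (pX j + pC c :: 'a mpoly) dvd r" by blast
    define \<pi> where "\<pi> = (pX j + pC c :: 'a mpoly)"
    have \<pi>: "irreducible \<pi>" "mvars \<pi> = {j}" "\<not> \<pi> dvd r"
      unfolding \<pi>_def by (rule irreducible_pX_add mvars_pX_add c)+
    define w where "w = r\<^sup>2 * (pX i ^ Suc (2 * deg i h) + \<pi>) + \<pi>\<^sup>2 * h\<^sup>2"
    have "irreducible w" unfolding w_def
      by (rule irreducible_combination_of_squares) (use h r \<pi> ri j in auto)
    moreover have "mvars w \<subseteq> {..<m}"
      unfolding w_def using rm \<pi>(2) h(3,4) j(1)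
      by (intro mvars_addI mvars_multI mvars_powerI) auto
    moreover have "g\<^sup>2 dvd (subst f r)\<^sup>2" "g\<^sup>2 dvd (subst f h)\<^sup>2"
      using h(1) r(1) unfolding Z_def by (simp_all add: dvd_power_same)
    then have "g\<^sup>2 dvd subst f w"
      unfolding w_def subst_add subst_mult subst_power
      by (intro dvd_add[OF dvd_mult2 dvd_mult])
    ultimately show ?thesis by blast
  next
    case False
    then have principal: "h dvd p" if "mvars p \<subseteq> {..<m}" "Z p" for p using that by blast
    define H where "H a = subst f (pdiff a h)" for a
    obtain q where q: "subst f h = g * q" using h(1) unfolding Z_def by blast
    have parallel: "g dvd u a * H b0 - u b0 * H a" if a: "a < m" for a
    proof -
      \<comment> \<open>Orthogonal to (grad h)(f) by construction, hence a derivation because P =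
        (h). Its annihilation by u is the vanishing modulo g of a 2 by 2 minor of u and (grad
        h)(f).\<close>
      define v where "v c = (if c = a then H b0 else 0) - (if c = b0 then H a else 0)" for c
      have sum_v: "(\<Sum>c<m. x c * v c) = x a * H b0 - x b0 * H a" for x
      proof -
        have "(\<Sum>c<m. x c * v c)
          = (\<Sum>c<m. (if c = a then x c * H b0 else 0) - (if c = b0 then x c * H a else 0))"
          by (rule sum.cong) (auto simp: v_def algebra_simps)
        then show ?thesis using a b0(1) by (simp add: sum_subtractf)
      qed
      have Dh: "deriv_along m v f h = 0"
        using sum_v[of H] by (simp add: deriv_along_def H_def mult.commute)
      have "derivation_mod g f m v"
        unfolding derivation_mod_def
      proof (intro allI impI)
        fix p assume "mvars p \<subseteq> {..<m}" "g dvd subst f p"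
        then obtain e where "p = h * e" using principal unfolding Z_def by blast
        then show "g dvd deriv_along m v f p"
          using h(1) Dh by (simp add: Z_def deriv_along_mult)
      qed
      then show ?thesis using annihilates[of v] sum_v[of u] by simp
    qed
    \<comment> \<open>Multiplied by \<open>u b0\<close>, (grad h)(f) J becomes \<open>H b0\<close>
      times u J modulo g, which is 0. So g divides the derivative of h(f) = g q, which is q d_l g
      modulo g.\<close>
    have dq: "g dvd q * pdiff l g" if l: "l < n" for l
    proof -
      let ?J = "\<lambda>a. pdiff l (f a)"
      have "g dvd H b0 * (\<Sum>a<m. u a * ?J a) - (\<Sum>a<m. (u a * H b0 - u b0 * H a) * ?J a)"
        using parallel u(2) l by (intro dvd_diff[OF dvd_mult dvd_sum[OF dvd_mult2]]) auto
      also have "\<dots> = u b0 * (\<Sum>a<m. H a * ?J a)"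
        by (simp add: sum_distrib_left sum_subtractf[symmetric] algebra_simps)
      finally have "g dvd (\<Sum>a<m. H a * ?J a)"
        using b0(2) prime_elem_dvd_multD[OF prime] by blast
      also have "(\<Sum>a<m. H a * ?J a) = pdiff l (subst f h)"
        by (simp add: pdiff_subst[OF h(3)] H_def)
      finally show ?thesis by (simp add: q pdiff_mult dvd_add_right_iff)
    qed
    obtain l where l: "l \<in> mvars g" using irreducible_mvars[OF g(1)] by blast
    then have "l < n" using g(2) by auto
    then have "g dvd q"
      using dq[of l] not_dvd_pdiff_self[OF l] prime_elem_dvd_multD[OF prime] by blast
    then have "g\<^sup>2 dvd subst f h" by (auto simp: q power2_eq_square mult_dvd_mono)
    then show ?thesis using h(2,3) by blast
  qed
qed

theorem theorem2p3:
  fixes n m :: nat and f :: "nat \<Rightarrow> 'a::field_char_0 mpoly" and g :: "'a mpoly"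
  assumes "1 \<le> m" and "m \<le> n"
    and "\<forall>a<m. in_vars n (f a)"
    and "in_vars n g" and "irreducible g"
  shows "(g dvd dgcd n m f \<longleftrightarrow>
            (\<exists>w. in_vars m w \<and> irreducible w \<and> g ^ 2 dvd subst f w))
       \<and> (g dvd dgcd n m f \<longleftrightarrow>
            (\<exists>w. in_vars m w \<and> squarefree w \<and> g ^ 2 dvd subst f w))"
proof -
  have prime: "prime_elem g" using irreducible_mpoly_imp_prime_elem assms(5) by blast
  have f: "\<And>a. a < m \<Longrightarrow> mvars (f a) \<subseteq> {..<n}" and g: "mvars g \<subseteq> {..<n}"
    using assms(3,4) unfolding in_vars_def by auto
  have 1: "\<exists>w. in_vars m w \<and> irreducible w \<and> g ^ 2 dvd subst f w" if "g dvd dgcd n m f"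
  proof -
    have "g dvd detm m (\<lambda>a b. pdiff (idx b) (f a))"
      if "strict_mono_on {..<m} idx" "\<forall>b<m. idx b < n" for idx
      using \<open>g dvd dgcd n m f\<close> that unfolding dvd_dgcd_iff jac_minors_def by blast
    then show ?thesis
      unfolding in_vars_def by (intro irreducible_square_dvd_if_dvd_minors[OF assms(5) g f])
  qed
  have 2: "g dvd dgcd n m f" if "in_vars m w" "squarefree w" "g ^ 2 dvd subst f w" for w
    using dvd_minor_if_square_dvd_squarefree[OF prime that(2) _ that(3)] that(1)
    unfolding dvd_dgcd_iff jac_minors_def in_vars_def by blast
  show ?thesis using 1 2 irreducible_imp_squarefree by blast
qed

end
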